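(* Let $G$ be an ERDF graph and let $F$ be an ERDF formula such that $V_F\cap sk_G(\mathit{Var}(G))=\emptyset$. Then: 1. If $F$ is an ERDF $d$-formula and $\langle G,\emptyset\rangle\models^{st}F$, then $G\models^{ERDF}F$. 2. If $G\models^{ERDF}F$, then $\langle G,\emptyset\rangle\models^{st}F$.
   Context: **Syntax.** $\mathcal{URI}$, $\mathcal{PL}$, $\mathcal{TL}$ are the sets of URI references, plain literals and typed literals; $\mathcal{LIT}=\mathcal{PL}\cup\mathcal{TL}$; $\mathit{Var}$ is a set of variables; $\mathcal{URI},\mathcal{LIT},\mathit{Var}$ are pairwise disjoint. A typed literal is a pair $``s"\hat{\ }\hat{\ }d$ of a string $s$ and a datatype URI $d$. A vocabulary is a subset of $\mathcal{URI}\cup\mathcal{LIT}$. A positive ERDF triple over $V$ is $p(s,o)$ with $p\in V\cap\mathcal{URI}$, $s,o\in V\cup\mathit{Var}$; a negative one is $\neg p(s,o)$; an ERDF triple is either. An ERDF graph is a set of ERDF triples over some vocabulary. $L(V)$, the set of ERDF formulas over $V$, is the smallest set containing the positive ERDF triples over $V$ and closed under $\sim F$ (weak negation), $\neg F$ (strong negation), $F\wedge G$, $F\vee G$, $F\supset G$, $\exists xF$, $\forall xF$ ($x\in\mathit{Var}$). $\mathit{Var}(\cdot)$, $\mathit{FVar}(\cdot)$ denote the variables and free variables, and $V_X$ the set of URIs and literals appearing in $X$. No variable has both free and bound occurrences in a formula, or more than one bound occurrence. An ERDF $d$-formula is an ERDF formula $F$ that is a disjunction of existentially quantified conjunctions of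 ERDF triples, with $\mathit{FVar}(F)=\emptyset$. **Partial interpretations.** A partial interpretation $I$ of $V$ consists of a non-empty set $Res_I$; a set $Prop_I$; $I_V:V\cap\mathcal{URI}\to Res_I\cup Prop_I$; $PT_I,PF_I:Prop_I\to\mathcal P(Res_I\times Res_I)$; $IL_I:V\cap\mathcal{TL}\to Res_I$; and $LV_I\subseteq Res_I$ with $V\cap\mathcal{PL}\subseteq LV_I$. The denotation $I:V\to Res_I\cup Prop_I$ is $I_V$ on URIs, the identity on plain literals, $IL_I$ on typed literals. $I$ is coherent if $PT_I(x)\cap PF_I(x)=\emptyset$ for all $x\in Prop_I$. For a valuation $v$ (partial map $\mathit{Var}\to Res_I$), $[I+v]$ is $v$ on variables and $I$ on $V$. Satisfaction $I,v\models F$ ($v:\mathit{Var}(F)\to Res_I$): $I,v\models p(s,o)$ (resp. $\neg p(s,o)$) iff $p\in V\cap\mathcal{URI}$, $s,o\in V\cup\mathit{Var}$, $I(p)\in Prop_I$ and $\langle[I+v](s),[I+v](o)\rangle\in PT_I(I(p))$ (resp. $\in PF_I(I(p))$); $I,v\models\ \sim G$ iff $V_G\subseteq V$ and $I,v\not\models G$; $\wedge,\vee$ as usual; $I,v\models F_1\supset F_2$ iff $I,v\models\ \sim F_1\vee F_2$; $I,v\models\exists xG$ (resp. $\forall xG$) iff for some (resp. all) $u:\mathit{Var}(G)\to Res_I$ agreeing with $v$ on $\mathit{Var}(G)\setminus\{x\}$, $I,u\models G$; other strongly negated formulas are rewritten by $\neg(F\wedge G)\to\neg F\vee\neg G$,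 $\neg(F\vee G)\to\neg F\wedge\neg G$, $\neg\neg F\to F$, $\neg\sim F\to F$, $\neg\exists xF\to\forall x\neg F$, $\neg\forall xF\to\exists x\neg F$, $\neg(F\supset G)\to F\wedge\neg G$. $I\models F$ iff $I,v\models F$ for all $v:\mathit{Var}(F)\to Res_I$. For an ERDF graph $G$, $I\models G$ iff there is $v:\mathit{Var}(G)\to Res_I$ with $I,v\models t$ for all $t\in G$. **Predefined vocabularies** (namespace prefixes rdf:, rdfs:, erdf: omitted; $i\in\{1,2,\dots\}$). $\mathcal V_{RDF}$ (rdf:) $=\{\mathtt{type},\mathtt{Property},\mathtt{XMLLiteral},\mathtt{nil},\mathtt{List},\mathtt{Statement},\mathtt{subject},\mathtt{predicate},\mathtt{object},\mathtt{first},\mathtt{rest},\mathtt{Seq},\mathtt{Bag},\mathtt{Alt},\mathtt{value}\}\cup\{\mathtt{\_i}\}_i$. $\mathcal V_{RDFS}$ (rdfs:) $=\{\mathtt{domain},\mathtt{range},\mathtt{Resource},\mathtt{Literal},\mathtt{Datatype},\mathtt{Class},\mathtt{subClassOf},\mathtt{subPropertyOf},\mathtt{member},\mathtt{Container},\mathtt{ContainerMembershipProperty},\mathtt{comment},\mathtt{seeAlso},\mathtt{isDefinedBy},\mathtt{label}\}$. $\mathcal V_{ERDF}$ (erdf:) $=\{\mathtt{TotalClass},\mathtt{TotalProperty}\}$. **Axiomatic triples.** RDF: $\mathtt{type}(x,\mathtt{Property})$ for $x\in\{\mathtt{type},\mathtt{subject},\mathtt{predicate},\mathtt{object},\mathtt{first},\mathtt{rest},\mathtt{value},\mathtt{\_i}\}$;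 $\mathtt{type}(\mathtt{nil},\mathtt{List})$. RDFS: $\mathtt{domain}(x,\mathtt{Resource})$ for $x\in\{\mathtt{type},\mathtt{member},\mathtt{seeAlso},\mathtt{isDefinedBy},\mathtt{comment},\mathtt{label},\mathtt{value},\mathtt{\_i}\}$; $\mathtt{domain}(x,\mathtt{Property})$ for $x\in\{\mathtt{domain},\mathtt{range},\mathtt{subPropertyOf}\}$; $\mathtt{domain}(\mathtt{subClassOf},\mathtt{Class})$; $\mathtt{domain}(x,\mathtt{Statement})$ for $x\in\{\mathtt{subject},\mathtt{predicate},\mathtt{object}\}$; $\mathtt{domain}(x,\mathtt{List})$ for $x\in\{\mathtt{first},\mathtt{rest}\}$; $\mathtt{range}(x,\mathtt{Class})$ for $x\in\{\mathtt{type},\mathtt{domain},\mathtt{range},\mathtt{subClassOf}\}$; $\mathtt{range}(\mathtt{subPropertyOf},\mathtt{Property})$; $\mathtt{range}(x,\mathtt{Resource})$ for $x\in\{\mathtt{subject},\mathtt{predicate},\mathtt{object},\mathtt{member},\mathtt{first},\mathtt{seeAlso},\mathtt{isDefinedBy},\mathtt{value},\mathtt{\_i}\}$; $\mathtt{range}(\mathtt{rest},\mathtt{List})$; $\mathtt{range}(x,\mathtt{Literal})$ for $x\in\{\mathtt{comment},\mathtt{label}\}$; $\mathtt{subClassOf}(x,\mathtt{Container})$ for $x\in\{\mathtt{Alt},\mathtt{Bag},\mathtt{Seq}\}$; $\mathtt{subClassOf}(\mathtt{ContainerMembershipProperty},\mathtt{Property})$; $\mathtt{subClassOf}(\mathtt{XMLLiteral},\mathtt{Literal})$;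 $\mathtt{subClassOf}(\mathtt{Datatype},\mathtt{Class})$; $\mathtt{subPropertyOf}(\mathtt{isDefinedBy},\mathtt{seeAlso})$; $\mathtt{type}(\mathtt{XMLLiteral},\mathtt{Datatype})$; $\mathtt{type}(\mathtt{\_i},\mathtt{ContainerMembershipProperty})$. ERDF: $\mathtt{subClassOf}(\mathtt{TotalClass},\mathtt{Class})$; $\mathtt{subClassOf}(\mathtt{TotalProperty},\mathtt{Property})$. **ERDF interpretation** of $V$: a coherent partial interpretation $I$ of $V'=V\cup\mathcal V_{RDF}\cup\mathcal V_{RDFS}\cup\mathcal V_{ERDF}$ (satisfaction is with respect to $V'$), with sets $Cls_I\subseteq Res_I$, $TCls_I\subseteq Cls_I$, $TProp_I\subseteq Prop_I$ and maps $CT_I,CF_I:Cls_I\to\mathcal P(Res_I)$ such that: (1) $x\in CT_I(y)$ iff $\langle x,y\rangle\in PT_I(I(\mathtt{type}))$; $x\in CF_I(y)$ iff $\langle x,y\rangle\in PF_I(I(\mathtt{type}))$. (2) $Prop_I,Cls_I,Res_I,LV_I,TCls_I,TProp_I$ equal $CT_I(I(c))$ for $c=\mathtt{Property},\mathtt{Class},\mathtt{Resource},\mathtt{Literal},\mathtt{TotalClass},\mathtt{TotalProperty}$ respectively. (3) If $\langle x,y\rangle\in PT_I(I(\mathtt{domain}))$ and $\langle z,w\rangle\in PT_I(x)$ then $z\in CT_I(y)$; if $\langle x,y\rangle\in PT_I(I(\mathtt{range}))$ and $\langle z,w\rangle\in PT_I(x)$ then $w\in CT_I(y)$. (4) $x\in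 Cls_I$ implies $\langle x,I(\mathtt{Resource})\rangle\in PT_I(I(\mathtt{subClassOf}))$. (5) $\langle x,y\rangle\in PT_I(I(\mathtt{subClassOf}))$ implies $x,y\in Cls_I$, $CT_I(x)\subseteq CT_I(y)$, $CF_I(y)\subseteq CF_I(x)$; $PT_I(I(\mathtt{subClassOf}))$ is reflexive and transitive on $Cls_I$. (6) $\langle x,y\rangle\in PT_I(I(\mathtt{subPropertyOf}))$ implies $x,y\in Prop_I$, $PT_I(x)\subseteq PT_I(y)$, $PF_I(y)\subseteq PF_I(x)$; $PT_I(I(\mathtt{subPropertyOf}))$ is reflexive and transitive on $Prop_I$. (7) $x\in CT_I(I(\mathtt{Datatype}))$ implies $\langle x,I(\mathtt{Literal})\rangle\in PT_I(I(\mathtt{subClassOf}))$; $x\in CT_I(I(\mathtt{ContainerMembershipProperty}))$ implies $\langle x,I(\mathtt{member})\rangle\in PT_I(I(\mathtt{subPropertyOf}))$. (8) $x\in TCls_I$ implies $CT_I(x)\cup CF_I(x)=Res_I$; $x\in TProp_I$ implies $PT_I(x)\cup PF_I(x)=Res_I\times Res_I$. (9) If $l=``s"\hat{\ }\hat{\ }\mathtt{XMLLiteral}\in V$ with $s$ a well-typed XML literal string, then $IL_I(l)$ is the XML value of $s$ and lies in $CT_I(I(\mathtt{XMLLiteral}))$; if $s$ is ill-typed, $IL_I(l)\in Res_I\setminus LV_I$ and $IL_I(l)\in CF_I(I(\mathtt{Literal}))$ (well-typedness and XML values as in the W3C RDF Recommendation). (10) $I$ satisfies all axiomatic triples above. **ERDF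 entailment.** For ERDF formulas or graphs $F,F'$: $F\models^{ERDF}F'$ iff every ERDF interpretation $I$ (of any vocabulary) with $I\models F$ satisfies $I\models F'$. **The ontology $O=\langle G,\emptyset\rangle$** (ERDF graph $G$, empty set of rules). The skolemization function $sk_G:\mathit{Var}(G)\to\mathcal{URI}$ is injective with values in artificial (fresh) URIs; $sk(G)$ is $G$ with each variable $x$ replaced by $sk_G(x)$. $V_O=V_{sk(G)}\cup\mathcal V_{RDF}\cup\mathcal V_{RDFS}\cup\mathcal V_{ERDF}$. $Res^H_O$ is the union of $V_O$ and the set of XML values of the well-typed XML literals in $V_O$, minus the well-typed XML literals. A Herbrand interpretation of $O$ is an ERDF interpretation $I$ of $V_O$ with $Res_I=Res^H_O$; $I_V(x)=x$ for $x\in V_O\cap\mathcal{URI}$; $IL_I(x)=x$ for typed literals $x\in V_O$ that are not well-typed XML literals, and $IL_I(x)$ the XML value of $x$ for well-typed XML literals. $\mathcal I^H(O)$ is the set of these. For $I,J\in\mathcal I^H(O)$: $I\le J$ iff $Prop_I\subseteq Prop_J$ and $PT_I(p)\subseteq PT_J(p)$, $PF_I(p)\subseteq PF_J(p)$ for all $p\in Prop_I$; $minimal(\mathcal I)=\{I\in\mathcal I:\nexists J\in\mathcal I,\ J\ne I,\ J\le I\}$. **Stable models and stable entailment.** In general, for an ontology $O=\langle G,P\rangle$ with rule set $P$, $M\in\mathcal I^H(O)$ is a stable model iff there is a (finite) chain $I_0\le\dots\le I_{k+1}$ in $\mathcal I^H(O)$ with $I_k=I_{k+1}=M$, $I_0\in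 minimal(\{I\in\mathcal I^H(O): I\models sk(G)\})$ and, for $0<\alpha\le k+1$, $I_\alpha\in minimal(\{I\in\mathcal I^H(O): I\ge I_{\alpha-1}$ and $I$ satisfies the conclusions of all ground instances over $V_O$ of rules of $P$ whose conditions hold in every $J\in\mathcal I^H(O)$ with $I_{\alpha-1}\le J\le M\})$. Here $P=\emptyset$, so the condition on rule conclusions is void. $\mathcal M^{st}(O)$ is the set of stable models, and $O\models^{st}F$ iff $M\models F$ for all $M\in\mathcal M^{st}(O)$. *)

theory Defs
  imports Main "HOL-Library.FuncSet"
begin

section \<open>Syntax\<close>

text \<open>
  The type \<open>'u uri\<close> is the set of URI references: the predefined names plus arbitrary further
  URIs from \<open>'u\<close>. The name rdf:_i is \<open>rdf_idx i\<close>; it belongs to the RDF vocabulary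
  only for \<open>i \<ge> 1\<close>, so \<open>rdf_idx 0\<close> is just another URI.
\<close>

datatype 'u uri =
    rdf_type | rdf_Property | rdf_XMLLiteral | rdf_nil | rdf_List | rdf_Statement
  | rdf_subject | rdf_predicate | rdf_object | rdf_first | rdf_rest
  | rdf_Seq | rdf_Bag | rdf_Alt | rdf_value | rdf_idx nat
  | rdfs_domain | rdfs_range | rdfs_Resource | rdfs_Literal | rdfs_Datatype | rdfs_Class
  | rdfs_subClassOf | rdfs_subPropertyOf | rdfs_member | rdfs_Container
  | rdfs_ContainerMembershipProperty | rdfs_comment | rdfs_seeAlso | rdfs_isDefinedBy | rdfs_label
  | erdf_TotalClass | erdf_TotalProperty
  | URI 'u

text \<open>Plain literals are the elements of \<open>'p\<close>; strings of typed literals those of \<open>'s\<close>.\<close>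

type_synonym ('u, 's) tlit = "'s \<times> 'u uri"

datatype ('u, 'p, 's) sym = U "'u uri" | PL 'p | TL "('u, 's) tlit"

datatype ('u, 'p, 's, 'v) trm = Var 'v | Sym "('u, 'p, 's) sym"

text \<open>\<open>Weak\<close> is weak negation (\<open>\<sim>\<close>), \<open>Neg\<close> is strong negation (\<open>\<not>\<close>).\<close>

datatype ('u, 'p, 's, 'v) fm =
    Tr "'u uri" "('u, 'p, 's, 'v) trm" "('u, 'p, 's, 'v) trm"
  | Weak "('u, 'p, 's, 'v) fm"
  | Neg "('u, 'p, 's, 'v) fm"
  | Conj "('u, 'p, 's, 'v) fm" "('u, 'p, 's, 'v) fm"
  | Disj "('u, 'p, 's, 'v) fm" "('u, 'p, 's, 'v) fm"
  | Impl "('u, 'p, 's, 'v) fm" "('u, 'p, 's, 'v) fm"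
  | Ex 'v "('u, 'p, 's, 'v) fm"
  | All 'v "('u, 'p, 's, 'v) fm"

fun tvars :: "('u, 'p, 's, 'v) trm \<Rightarrow> 'v set" where
  "tvars (Var x) = {x}"
| "tvars (Sym c) = {}"

fun tsyms :: "('u, 'p, 's, 'v) trm \<Rightarrow> ('u, 'p, 's) sym set" where
  "tsyms (Var x) = {}"
| "tsyms (Sym c) = {c}"

fun vars :: "('u, 'p, 's, 'v) fm \<Rightarrow> 'v set" where
  "vars (Tr p s t) = tvars s \<union> tvars t"
| "vars (Weak F) = vars F"
| "vars (Neg F) = vars F"
| "vars (Conj F G) = vars F \<union> vars G"
| "vars (Disj F G) = vars F \<union> vars G"
| "vars (Impl F G) = vars F \<union> vars G"
| "vars (Ex x F) = insert x (vars F)"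
| "vars (All x F) = insert x (vars F)"

fun fvars :: "('u, 'p, 's, 'v) fm \<Rightarrow> 'v set" where
  "fvars (Tr p s t) = tvars s \<union> tvars t"
| "fvars (Weak F) = fvars F"
| "fvars (Neg F) = fvars F"
| "fvars (Conj F G) = fvars F \<union> fvars G"
| "fvars (Disj F G) = fvars F \<union> fvars G"
| "fvars (Impl F G) = fvars F \<union> fvars G"
| "fvars (Ex x F) = fvars F - {x}"
| "fvars (All x F) = fvars F - {x}"

text \<open>The variables bound by the quantifiers of a formula, one entry per quantifier.\<close>

fun bvars :: "('u, 'p, 's, 'v) fm \<Rightarrow> 'v list" where
  "bvars (Tr p s t) = []"
| "bvars (Weak F) = bvars F"
| "bvars (Neg F) = bvars F"
| "bvars (Conj F G) = bvars F @ bvars G"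
| "bvars (Disj F G) = bvars F @ bvars G"
| "bvars (Impl F G) = bvars F @ bvars G"
| "bvars (Ex x F) = x # bvars F"
| "bvars (All x F) = x # bvars F"

text \<open>\<open>syms F\<close> is \<open>V\<^sub>F\<close>. The datatype URI inside a typed literal does not count as a
  separate occurrence of that URI.\<close>

fun syms :: "('u, 'p, 's, 'v) fm \<Rightarrow> ('u, 'p, 's) sym set" where
  "syms (Tr p s t) = insert (U p) (tsyms s \<union> tsyms t)"
| "syms (Weak F) = syms F"
| "syms (Neg F) = syms F"
| "syms (Conj F G) = syms F \<union> syms G"
| "syms (Disj F G) = syms F \<union> syms G"
| "syms (Impl F G) = syms F \<union> syms G"
| "syms (Ex x F) = syms F"
| "syms (All x F) = syms F"

text \<open>
  Every element of type \<open>fm\<close> is a formula over the vocabulary \<open>syms F\<close>; what remains of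
  being an ERDF formula is the convention that no variable occurs both free and bound and that no
  variable is bound by two quantifiers.
\<close>

definition erdf_formula :: "('u, 'p, 's, 'v) fm \<Rightarrow> bool" where
  "erdf_formula F \<longleftrightarrow> fvars F \<inter> set (bvars F) = {} \<and> distinct (bvars F)"

fun erdf_triple :: "('u, 'p, 's, 'v) fm \<Rightarrow> bool" where
  "erdf_triple (Tr p s t) = True"
| "erdf_triple (Neg (Tr p s t)) = True"
| "erdf_triple _ = False"

definition erdf_graph :: "('u, 'p, 's, 'v) fm set \<Rightarrow> bool" where
  "erdf_graph G \<longleftrightarrow> (\<forall>t\<in>G. erdf_triple t)"

definition gvars :: "('u, 'p, 's, 'v) fm set \<Rightarrow> 'v set" where
  "gvars G = (\<Union>t\<in>G. vars t)"

definition gsyms :: "('u, 'p, 's, 'v) fm set \<Rightarrow> ('u, 'p, 's) sym set" where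
  "gsyms G = (\<Union>t\<in>G. syms t)"

inductive triple_conj :: "('u, 'p, 's, 'v) fm \<Rightarrow> bool" where
  "erdf_triple t \<Longrightarrow> triple_conj t"
| "triple_conj F \<Longrightarrow> triple_conj G \<Longrightarrow> triple_conj (Conj F G)"

inductive ex_triple_conj :: "('u, 'p, 's, 'v) fm \<Rightarrow> bool" where
  "triple_conj F \<Longrightarrow> ex_triple_conj F"
| "ex_triple_conj F \<Longrightarrow> ex_triple_conj (Ex x F)"

inductive ex_triple_disj :: "('u, 'p, 's, 'v) fm \<Rightarrow> bool" where
  "ex_triple_conj F \<Longrightarrow> ex_triple_disj F"
| "ex_triple_disj F \<Longrightarrow> ex_triple_disj G \<Longrightarrow> ex_triple_disj (Disj F G)"

definition d_formula :: "('u, 'p, 's, 'v) fm \<Rightarrow> bool" where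
  "d_formula F \<longleftrightarrow> erdf_formula F \<and> ex_triple_disj F \<and> fvars F = {}"

text \<open>Substitution for free variables. It is only used with variable-free terms \<open>\<sigma> x\<close>, so
  there is no capture.\<close>

fun tinst :: "('v \<Rightarrow> ('u, 'p, 's, 'v) trm) \<Rightarrow> ('u, 'p, 's, 'v) trm \<Rightarrow> ('u, 'p, 's, 'v) trm" where
  "tinst \<sigma> (Var x) = \<sigma> x"
| "tinst \<sigma> (Sym c) = Sym c"

fun inst :: "('v \<Rightarrow> ('u, 'p, 's, 'v) trm) \<Rightarrow> ('u, 'p, 's, 'v) fm \<Rightarrow> ('u, 'p, 's, 'v) fm" where
  "inst \<sigma> (Tr p s t) = Tr p (tinst \<sigma> s) (tinst \<sigma> t)"
| "inst \<sigma> (Weak F) = Weak (inst \<sigma> F)"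
| "inst \<sigma> (Neg F) = Neg (inst \<sigma> F)"
| "inst \<sigma> (Conj F G) = Conj (inst \<sigma> F) (inst \<sigma> G)"
| "inst \<sigma> (Disj F G) = Disj (inst \<sigma> F) (inst \<sigma> G)"
| "inst \<sigma> (Impl F G) = Impl (inst \<sigma> F) (inst \<sigma> G)"
| "inst \<sigma> (Ex x F) = Ex x (inst (\<sigma>(x := Var x)) F)"
| "inst \<sigma> (All x F) = All x (inst (\<sigma>(x := Var x)) F)"


section \<open>Predefined vocabularies and axiomatic triples\<close>

definition V_RDF :: "'u uri set" where
  "V_RDF = {rdf_type, rdf_Property, rdf_XMLLiteral, rdf_nil, rdf_List, rdf_Statement, rdf_subject,
    rdf_predicate, rdf_object, rdf_first, rdf_rest, rdf_Seq, rdf_Bag, rdf_Alt, rdf_value}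
    \<union> {rdf_idx i | i. i \<ge> 1}"

definition V_RDFS :: "'u uri set" where
  "V_RDFS = {rdfs_domain, rdfs_range, rdfs_Resource, rdfs_Literal, rdfs_Datatype, rdfs_Class,
    rdfs_subClassOf, rdfs_subPropertyOf, rdfs_member, rdfs_Container,
    rdfs_ContainerMembershipProperty, rdfs_comment, rdfs_seeAlso, rdfs_isDefinedBy, rdfs_label}"

definition V_ERDF :: "'u uri set" where
  "V_ERDF = {erdf_TotalClass, erdf_TotalProperty}"

definition predef :: "('u, 'p, 's) sym set" where
  "predef = U ` (V_RDF \<union> V_RDFS \<union> V_ERDF)"

text \<open>Axiomatic triples contain no variables; \<open>unit\<close> merely fills the type parameter.\<close>

definition ax :: "'u uri \<Rightarrow> 'u uri \<Rightarrow> 'u uri \<Rightarrow> ('u, 'p, 's, unit) fm" where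
  "ax p s t = Tr p (Sym (U s)) (Sym (U t))"

definition rdf_axioms :: "('u, 'p, 's, unit) fm set" where
  "rdf_axioms =
    {ax rdf_type x rdf_Property | x.
      x \<in> {rdf_type, rdf_subject, rdf_predicate, rdf_object, rdf_first, rdf_rest, rdf_value}
        \<union> {rdf_idx i | i. i \<ge> 1}}
    \<union> {ax rdf_type rdf_nil rdf_List}"

definition rdfs_axioms :: "('u, 'p, 's, unit) fm set" where
  "rdfs_axioms =
    {ax rdfs_domain x rdfs_Resource | x.
      x \<in> {rdf_type, rdfs_member, rdfs_seeAlso, rdfs_isDefinedBy, rdfs_comment, rdfs_label, rdf_value}
        \<union> {rdf_idx i | i. i \<ge> 1}}
    \<union> {ax rdfs_domain x rdf_Property | x. x \<in> {rdfs_domain, rdfs_range, rdfs_subPropertyOf}}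
    \<union> {ax rdfs_domain rdfs_subClassOf rdfs_Class}
    \<union> {ax rdfs_domain x rdf_Statement | x. x \<in> {rdf_subject, rdf_predicate, rdf_object}}
    \<union> {ax rdfs_domain x rdf_List | x. x \<in> {rdf_first, rdf_rest}}
    \<union> {ax rdfs_range x rdfs_Class | x. x \<in> {rdf_type, rdfs_domain, rdfs_range, rdfs_subClassOf}}
    \<union> {ax rdfs_range rdfs_subPropertyOf rdf_Property}
    \<union> {ax rdfs_range x rdfs_Resource | x.
      x \<in> {rdf_subject, rdf_predicate, rdf_object, rdfs_member, rdf_first, rdfs_seeAlso,
            rdfs_isDefinedBy, rdf_value}
        \<union> {rdf_idx i | i. i \<ge> 1}}
    \<union> {ax rdfs_range rdf_rest rdf_List}
    \<union> {ax rdfs_range x rdfs_Literal | x. x \<in> {rdfs_comment, rdfs_label}}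
    \<union> {ax rdfs_subClassOf x rdfs_Container | x. x \<in> {rdf_Alt, rdf_Bag, rdf_Seq}}
    \<union> {ax rdfs_subClassOf rdfs_ContainerMembershipProperty rdf_Property,
       ax rdfs_subClassOf rdf_XMLLiteral rdfs_Literal,
       ax rdfs_subClassOf rdfs_Datatype rdfs_Class,
       ax rdfs_subPropertyOf rdfs_isDefinedBy rdfs_seeAlso,
       ax rdf_type rdf_XMLLiteral rdfs_Datatype}
    \<union> {ax rdf_type (rdf_idx i) rdfs_ContainerMembershipProperty | i. i \<ge> 1}"

definition erdf_axioms :: "('u, 'p, 's, unit) fm set" where
  "erdf_axioms =
    {ax rdfs_subClassOf erdf_TotalClass rdfs_Class,
     ax rdfs_subClassOf erdf_TotalProperty rdf_Property}"


section \<open>Partial interpretations\<close>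

text \<open>
  The universe from which the resources of an interpretation are drawn: URIs and literals
  themselves, XML values, and arbitrary further objects from \<open>'e\<close>. By the RDF Recommendation
  the XML values are in one-to-one correspondence with the well-typed XML literal strings and
  are neither strings nor literals, so \<open>XMLval s\<close> represents the XML value of such an \<open>s\<close>.
\<close>

datatype ('u, 'p, 's, 'e) res = RSym "('u, 'p, 's) sym" | XMLval 's | Obj 'e

record ('u, 'p, 's, 'e) pinterp =
  Res :: "('u, 'p, 's, 'e) res set"
  Props :: "('u, 'p, 's, 'e) res set"
  IV :: "'u uri \<Rightarrow> ('u, 'p, 's, 'e) res"
  PT :: "('u, 'p, 's, 'e) res \<Rightarrow> (('u, 'p, 's, 'e) res \<times> ('u, 'p, 's, 'e) res) set"
  PF :: "('u, 'p, 's, 'e) res \<Rightarrow> (('u, 'p, 's, 'e) res \<times> ('u, 'p, 's, 'e) res) set"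
  IL :: "('u, 's) tlit \<Rightarrow> ('u, 'p, 's, 'e) res"
  LV :: "('u, 'p, 's, 'e) res set"

text \<open>
  Maps with a restricted domain are total functions with a fixed value outside the domain
  (\<open>undefined\<close> for \<open>IV\<close> and \<open>IL\<close>, the empty set for set-valued maps), so that two
  interpretations are equal as records iff they agree on all domains.
\<close>

definition partial_interp ::
  "('u, 'p, 's) sym set \<Rightarrow> ('u, 'p, 's, 'e, 'm) pinterp_scheme \<Rightarrow> bool" where
  "partial_interp V I \<longleftrightarrow>
     Res I \<noteq> {} \<and>
     IV I \<in> {u. U u \<in> V} \<rightarrow>\<^sub>E Res I \<union> Props I \<and>
     (\<forall>x\<in>Props I. PT I x \<subseteq> Res I \<times> Res I \<and> PF I x \<subseteq> Res I \<times> Res I) \<and>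
     (\<forall>x. x \<notin> Props I \<longrightarrow> PT I x = {} \<and> PF I x = {}) \<and>
     IL I \<in> {l. TL l \<in> V} \<rightarrow>\<^sub>E Res I \<and>
     LV I \<subseteq> Res I \<and>
     (\<forall>c. PL c \<in> V \<longrightarrow> RSym (PL c) \<in> LV I)"

definition coherent :: "('u, 'p, 's, 'e, 'm) pinterp_scheme \<Rightarrow> bool" where
  "coherent I \<longleftrightarrow> (\<forall>x\<in>Props I. PT I x \<inter> PF I x = {})"

fun den :: "('u, 'p, 's, 'e, 'm) pinterp_scheme \<Rightarrow> ('u, 'p, 's) sym \<Rightarrow> ('u, 'p, 's, 'e) res" where
  "den I (U u) = IV I u"
| "den I (PL c) = RSym (PL c)"
| "den I (TL l) = IL I l"

text \<open>Valuations are total functions; only their values on the variables of the formula matter,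
  and these are required to lie in \<open>Res I\<close> wherever a valuation is quantified.\<close>

fun tden :: "('u, 'p, 's, 'e, 'm) pinterp_scheme \<Rightarrow> ('v \<Rightarrow> ('u, 'p, 's, 'e) res)
    \<Rightarrow> ('u, 'p, 's, 'v) trm \<Rightarrow> ('u, 'p, 's, 'e) res" where
  "tden I v (Var x) = v x"
| "tden I v (Sym c) = den I c"

text \<open>Used only to show that the rewriting of strongly negated formulas terminates.\<close>

fun weight :: "('u, 'p, 's, 'v) fm \<Rightarrow> nat" where
  "weight (Tr p s t) = 1"
| "weight (Weak F) = weight F + 1"
| "weight (Neg F) = 2 * weight F"
| "weight (Conj F G) = weight F + weight G + 1"
| "weight (Disj F G) = weight F + weight G + 1"
| "weight (Impl F G) = weight F + weight G + 3"
| "weight (Ex x F) = weight F + 1"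
| "weight (All x F) = weight F + 1"

lemma weight_pos [simp]: "0 < weight F"
  by (induction F) auto

function sat :: "('u, 'p, 's) sym set \<Rightarrow> ('u, 'p, 's, 'e, 'm) pinterp_scheme
    \<Rightarrow> ('v \<Rightarrow> ('u, 'p, 's, 'e) res) \<Rightarrow> ('u, 'p, 's, 'v) fm \<Rightarrow> bool" where
  "sat V I v (Tr p s t) \<longleftrightarrow>
     U p \<in> V \<and> tsyms s \<subseteq> V \<and> tsyms t \<subseteq> V \<and> den I (U p) \<in> Props I \<and>
     (tden I v s, tden I v t) \<in> PT I (den I (U p))"
| "sat V I v (Neg (Tr p s t)) \<longleftrightarrow>
     U p \<in> V \<and> tsyms s \<subseteq> V \<and> tsyms t \<subseteq> V \<and> den I (U p) \<in> Props I \<and>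
     (tden I v s, tden I v t) \<in> PF I (den I (U p))"
| "sat V I v (Weak F) \<longleftrightarrow> syms F \<subseteq> V \<and> \<not> sat V I v F"
| "sat V I v (Conj F G) \<longleftrightarrow> sat V I v F \<and> sat V I v G"
| "sat V I v (Disj F G) \<longleftrightarrow> sat V I v F \<or> sat V I v G"
| "sat V I v (Impl F G) \<longleftrightarrow> sat V I v (Disj (Weak F) G)"
| "sat V I v (Ex x F) \<longleftrightarrow>
     (\<exists>u \<in> vars F \<rightarrow> Res I. (\<forall>y\<in>vars F - {x}. u y = v y) \<and> sat V I u F)"
| "sat V I v (All x F) \<longleftrightarrow>
     (\<forall>u \<in> vars F \<rightarrow> Res I. (\<forall>y\<in>vars F - {x}. u y = v y) \<longrightarrow> sat V I u F)"
| "sat V I v (Neg (Conj F G)) \<longleftrightarrow> sat V I v (Disj (Neg F) (Neg G))"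
| "sat V I v (Neg (Disj F G)) \<longleftrightarrow> sat V I v (Conj (Neg F) (Neg G))"
| "sat V I v (Neg (Neg F)) \<longleftrightarrow> sat V I v F"
| "sat V I v (Neg (Weak F)) \<longleftrightarrow> sat V I v F"
| "sat V I v (Neg (Ex x F)) \<longleftrightarrow> sat V I v (All x (Neg F))"
| "sat V I v (Neg (All x F)) \<longleftrightarrow> sat V I v (Ex x (Neg F))"
| "sat V I v (Neg (Impl F G)) \<longleftrightarrow> sat V I v (Conj F (Neg G))"
  by pat_completeness auto
termination
  by (relation "measure (\<lambda>(V, I, v, F). weight F)") auto

definition models :: "('u, 'p, 's) sym set \<Rightarrow> ('u, 'p, 's, 'e, 'm) pinterp_scheme
    \<Rightarrow> ('u, 'p, 's, 'v) fm \<Rightarrow> bool" where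
  "models V I F \<longleftrightarrow> (\<forall>v \<in> vars F \<rightarrow> Res I. sat V I v F)"

definition models_graph :: "('u, 'p, 's) sym set \<Rightarrow> ('u, 'p, 's, 'e, 'm) pinterp_scheme
    \<Rightarrow> ('u, 'p, 's, 'v) fm set \<Rightarrow> bool" where
  "models_graph V I G \<longleftrightarrow> (\<exists>v \<in> gvars G \<rightarrow> Res I. \<forall>t\<in>G. sat V I v t)"


section \<open>ERDF interpretations and ERDF entailment\<close>

record ('u, 'p, 's, 'e) einterp = "('u, 'p, 's, 'e) pinterp" +
  Cls :: "('u, 'p, 's, 'e) res set"
  TCls :: "('u, 'p, 's, 'e) res set"
  TProp :: "('u, 'p, 's, 'e) res set"
  CT :: "('u, 'p, 's, 'e) res \<Rightarrow> ('u, 'p, 's, 'e) res set"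
  CF :: "('u, 'p, 's, 'e) res \<Rightarrow> ('u, 'p, 's, 'e) res set"

text \<open>
  The parameter \<open>X\<close> is the set of well-typed XML literal strings. The sets \<open>PT I x\<close> and
  \<open>CT I y\<close>, \<open>CF I y\<close> are empty for \<open>x\<close> not in \<open>Props I\<close> and \<open>y\<close> not
  in \<open>Cls I\<close>, so membership in them includes membership of the argument in the domain.
\<close>

definition erdf_interp ::
  "'s set \<Rightarrow> ('u, 'p, 's) sym set \<Rightarrow> ('u, 'p, 's, 'e) einterp \<Rightarrow> bool" where
  "erdf_interp X V I \<longleftrightarrow>
     partial_interp (V \<union> predef) I \<and> coherent I \<and>
     Cls I \<subseteq> Res I \<and> TCls I \<subseteq> Cls I \<and> TProp I \<subseteq> Props I \<and>
     (\<forall>y\<in>Cls I. CT I y \<subseteq> Res I \<and> CF I y \<subseteq> Res I) \<and>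
     (\<forall>y. y \<notin> Cls I \<longrightarrow> CT I y = {} \<and> CF I y = {}) \<and>
     (\<forall>x y. x \<in> CT I y \<longleftrightarrow> (x, y) \<in> PT I (IV I rdf_type)) \<and>
     (\<forall>x y. x \<in> CF I y \<longleftrightarrow> (x, y) \<in> PF I (IV I rdf_type)) \<and>
     Props I = CT I (IV I rdf_Property) \<and>
     Cls I = CT I (IV I rdfs_Class) \<and>
     Res I = CT I (IV I rdfs_Resource) \<and>
     LV I = CT I (IV I rdfs_Literal) \<and>
     TCls I = CT I (IV I erdf_TotalClass) \<and>
     TProp I = CT I (IV I erdf_TotalProperty) \<and>
     (\<forall>x y z w. (x, y) \<in> PT I (IV I rdfs_domain) \<and> (z, w) \<in> PT I x \<longrightarrow> z \<in> CT I y) \<and>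
     (\<forall>x y z w. (x, y) \<in> PT I (IV I rdfs_range) \<and> (z, w) \<in> PT I x \<longrightarrow> w \<in> CT I y) \<and>
     (\<forall>x\<in>Cls I. (x, IV I rdfs_Resource) \<in> PT I (IV I rdfs_subClassOf)) \<and>
     (\<forall>x y. (x, y) \<in> PT I (IV I rdfs_subClassOf) \<longrightarrow>
        x \<in> Cls I \<and> y \<in> Cls I \<and> CT I x \<subseteq> CT I y \<and> CF I y \<subseteq> CF I x) \<and>
     refl_on (Cls I) (PT I (IV I rdfs_subClassOf)) \<and>
     trans_on (Cls I) (PT I (IV I rdfs_subClassOf)) \<and>
     (\<forall>x y. (x, y) \<in> PT I (IV I rdfs_subPropertyOf) \<longrightarrow>
        x \<in> Props I \<and> y \<in> Props I \<and> PT I x \<subseteq> PT I y \<and> PF I y \<subseteq> PF I x) \<and>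
     refl_on (Props I) (PT I (IV I rdfs_subPropertyOf)) \<and>
     trans_on (Props I) (PT I (IV I rdfs_subPropertyOf)) \<and>
     (\<forall>x\<in>CT I (IV I rdfs_Datatype).
        (x, IV I rdfs_Literal) \<in> PT I (IV I rdfs_subClassOf)) \<and>
     (\<forall>x\<in>CT I (IV I rdfs_ContainerMembershipProperty).
        (x, IV I rdfs_member) \<in> PT I (IV I rdfs_subPropertyOf)) \<and>
     (\<forall>x\<in>TCls I. CT I x \<union> CF I x = Res I) \<and>
     (\<forall>x\<in>TProp I. PT I x \<union> PF I x = Res I \<times> Res I) \<and>
     (\<forall>s. TL (s, rdf_XMLLiteral) \<in> V \<and> s \<in> X \<longrightarrow>
        IL I (s, rdf_XMLLiteral) = XMLval s \<and>
        IL I (s, rdf_XMLLiteral) \<in> CT I (IV I rdf_XMLLiteral)) \<and>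
     (\<forall>s. TL (s, rdf_XMLLiteral) \<in> V \<and> s \<notin> X \<longrightarrow>
        IL I (s, rdf_XMLLiteral) \<in> Res I - LV I \<and>
        IL I (s, rdf_XMLLiteral) \<in> CF I (IV I rdfs_Literal)) \<and>
     (\<forall>t \<in> rdf_axioms \<union> rdfs_axioms \<union> erdf_axioms. models (V \<union> predef) I t)"

text \<open>
  Entailment of a formula by a graph, over all interpretations of all vocabularies with resources
  from the universe determined by \<open>'e\<close>. Leaving \<open>'e\<close> arbitrary in a theorem amounts to
  allowing arbitrary sets of resources.
\<close>

definition erdf_entails ::
  "'e itself \<Rightarrow> 's set \<Rightarrow> ('u, 'p, 's, 'v) fm set \<Rightarrow> ('u, 'p, 's, 'v) fm \<Rightarrow> bool" where
  "erdf_entails TYPE('e) X G F \<longleftrightarrow>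
     (\<forall>V (I :: ('u, 'p, 's, 'e) einterp). erdf_interp X V I \<longrightarrow>
        models_graph (V \<union> predef) I G \<longrightarrow> models (V \<union> predef) I F)"


section \<open>Ontologies, Herbrand interpretations and stable models\<close>

text \<open>A missing conclusion stands for \<open>false\<close>, a missing condition for \<open>true\<close>.\<close>

datatype ('u, 'p, 's, 'v) rule =
  Rule (concl: "('u, 'p, 's, 'v) fm option") (cond: "('u, 'p, 's, 'v) fm option")

definition rule_syms :: "('u, 'p, 's, 'v) rule \<Rightarrow> ('u, 'p, 's) sym set" where
  "rule_syms r = (\<Union>F \<in> set_option (concl r) \<union> set_option (cond r). syms F)"

definition ground_rules ::
  "('u, 'p, 's) sym set \<Rightarrow> ('u, 'p, 's, 'v) rule set \<Rightarrow> ('u, 'p, 's, 'v) rule set" where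
  "ground_rules V P =
     {Rule (map_option (inst (Sym \<circ> \<sigma>)) (concl r)) (map_option (inst (Sym \<circ> \<sigma>)) (cond r)) | r \<sigma>.
        r \<in> P \<and> range \<sigma> \<subseteq> V}"

definition models_concl :: "('u, 'p, 's) sym set \<Rightarrow> ('u, 'p, 's, 'e, 'm) pinterp_scheme
    \<Rightarrow> ('u, 'p, 's, 'v) rule \<Rightarrow> bool" where
  "models_concl V I r \<longleftrightarrow> (case concl r of None \<Rightarrow> False | Some F \<Rightarrow> models V I F)"

definition models_cond :: "('u, 'p, 's) sym set \<Rightarrow> ('u, 'p, 's, 'e, 'm) pinterp_scheme
    \<Rightarrow> ('u, 'p, 's, 'v) rule \<Rightarrow> bool" where
  "models_cond V I r \<longleftrightarrow> (case cond r of None \<Rightarrow> True | Some F \<Rightarrow> models V I F)"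

text \<open>The values of a skolemization function are pairwise different and fresh, i.e. neither
  predefined nor occurring in the graph.\<close>

definition skolemization :: "('v \<Rightarrow> 'u uri) \<Rightarrow> ('u, 'p, 's, 'v) fm set \<Rightarrow> bool" where
  "skolemization sk G \<longleftrightarrow>
     inj_on sk (gvars G) \<and> U ` sk ` gvars G \<inter> (gsyms G \<union> predef) = {}"

definition skolemize ::
  "('v \<Rightarrow> 'u uri) \<Rightarrow> ('u, 'p, 's, 'v) fm set \<Rightarrow> ('u, 'p, 's, 'v) fm set" where
  "skolemize sk G = inst (\<lambda>x. Sym (U (sk x))) ` G"

definition onto_voc :: "('v \<Rightarrow> 'u uri) \<Rightarrow> ('u, 'p, 's, 'v) fm set \<Rightarrow> ('u, 'p, 's, 'v) rule set
    \<Rightarrow> ('u, 'p, 's) sym set" where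
  "onto_voc sk G P = gsyms (skolemize sk G) \<union> (\<Union>r\<in>P. rule_syms r) \<union> predef"

definition herbrand_res :: "'s set \<Rightarrow> ('u, 'p, 's) sym set \<Rightarrow> ('u, 'p, 's, 'e) res set" where
  "herbrand_res X V =
     (RSym ` V \<union> {XMLval s | s. TL (s, rdf_XMLLiteral) \<in> V \<and> s \<in> X})
     - {RSym (TL (s, rdf_XMLLiteral)) | s. s \<in> X}"

definition herbrand :: "'s set \<Rightarrow> ('u, 'p, 's) sym set \<Rightarrow> ('u, 'p, 's, 'e) einterp set" where
  "herbrand X V = {I. erdf_interp X V I \<and> Res I = herbrand_res X V \<and>
     (\<forall>u. U u \<in> V \<longrightarrow> IV I u = RSym (U u)) \<and>
     (\<forall>s d. TL (s, d) \<in> V \<longrightarrow>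
        IL I (s, d) = (if d = rdf_XMLLiteral \<and> s \<in> X then XMLval s else RSym (TL (s, d))))}"

definition interp_le ::
  "('u, 'p, 's, 'e) einterp \<Rightarrow> ('u, 'p, 's, 'e) einterp \<Rightarrow> bool" (infix "\<preceq>" 50) where
  "I \<preceq> J \<longleftrightarrow> Props I \<subseteq> Props J \<and>
     (\<forall>p\<in>Props I. PT I p \<subseteq> PT J p \<and> PF I p \<subseteq> PF J p)"

definition minimal :: "('u, 'p, 's, 'e) einterp set \<Rightarrow> ('u, 'p, 's, 'e) einterp set" where
  "minimal \<I> = {I\<in>\<I>. \<not> (\<exists>J\<in>\<I>. J \<noteq> I \<and> J \<preceq> I)}"

definition stable_model :: "'s set \<Rightarrow> ('v \<Rightarrow> 'u uri) \<Rightarrow> ('u, 'p, 's, 'v) fm set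
    \<Rightarrow> ('u, 'p, 's, 'v) rule set \<Rightarrow> ('u, 'p, 's, 'e) einterp \<Rightarrow> bool" where
  "stable_model X sk G P M \<longleftrightarrow>
     (let V = onto_voc sk G P; H = herbrand X V in
      M \<in> H \<and>
      (\<exists>k (C :: nat \<Rightarrow> ('u, 'p, 's, 'e) einterp).
         (\<forall>\<alpha>\<le>k + 1. C \<alpha> \<in> H) \<and> (\<forall>\<alpha>\<le>k. C \<alpha> \<preceq> C (\<alpha> + 1)) \<and> C k = M \<and> C (k + 1) = M \<and>
         C 0 \<in> minimal {I\<in>H. models_graph V I (skolemize sk G)} \<and>
         (\<forall>\<alpha>. 0 < \<alpha> \<and> \<alpha> \<le> k + 1 \<longrightarrow>
            C \<alpha> \<in> minimal {I\<in>H. C (\<alpha> - 1) \<preceq> I \<and>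
              (\<forall>r\<in>ground_rules V P.
                 (\<forall>J\<in>H. C (\<alpha> - 1) \<preceq> J \<and> J \<preceq> M \<longrightarrow> models_cond V J r) \<longrightarrow> models_concl V I r)})))"

text \<open>All resources of a Herbrand interpretation are of the form \<open>RSym c\<close> or \<open>XMLval s\<close>,
  so the choice of \<open>'e\<close> is immaterial here.\<close>

definition stable_entails :: "'e itself \<Rightarrow> 's set \<Rightarrow> ('v \<Rightarrow> 'u uri) \<Rightarrow> ('u, 'p, 's, 'v) fm set
    \<Rightarrow> ('u, 'p, 's, 'v) rule set \<Rightarrow> ('u, 'p, 's, 'v) fm \<Rightarrow> bool" where
  "stable_entails TYPE('e) X sk G P F \<longleftrightarrow>
     (\<forall>M :: ('u, 'p, 's, 'e) einterp. stable_model X sk G P M \<longrightarrow> models (onto_voc sk G P) M F)"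

end

theory Submission
  imports Defs
begin

text \<open>
  Without rules, the stable models are exactly the minimal Herbrand models of \<open>sk(G)\<close>. Every such
  model satisfies \<open>G\<close>, by sending each variable to its skolem URI, which gives part 2.
  For part 1, let \<open>I\<close> be an ERDF model of \<open>G\<close> with witnesses \<open>u\<close>. The map \<open>h\<close> that sends skolem
  URIs to the values of \<open>u\<close> and all other symbols to their denotation pulls \<open>I\<close> back to a
  Herbrand model \<open>J\<close> of \<open>sk(G)\<close>. All closure conditions on ERDF interpretations survive
  intersections of chains, so Zorn's lemma yields a minimal Herbrand model \<open>M\<close> below \<open>J\<close>; it
  satisfies \<open>F\<close> by assumption, and \<open>h\<close> is a homomorphism from \<open>M\<close> to \<open>I\<close>, so it carries the positive
  existential formula \<open>F\<close> over to \<open>I\<close>.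
\<close>

section \<open>Predefined names, axiomatic triples and the clauses of an interpretation\<close>

abbreviation rsc :: "'u uri \<Rightarrow> ('u,'p,'s,'e) res" where "rsc u \<equiv> RSym (U u)"

lemma predef_mem [simp]:
  "U rdf_type \<in> predef" "U rdf_Property \<in> predef" "U rdf_XMLLiteral \<in> predef"
  "U rdf_nil \<in> predef" "U rdf_List \<in> predef" "U rdf_Statement \<in> predef"
  "U rdf_subject \<in> predef" "U rdf_predicate \<in> predef" "U rdf_object \<in> predef"
  "U rdf_first \<in> predef" "U rdf_rest \<in> predef" "U rdf_Seq \<in> predef" "U rdf_Bag \<in> predef"
  "U rdf_Alt \<in> predef" "U rdf_value \<in> predef" "U (rdf_idx i) \<in> predef \<longleftrightarrow> i \<ge> 1"
  "U rdfs_domain \<in> predef" "U rdfs_range \<in> predef" "U rdfs_Resource \<in> predef"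
  "U rdfs_Literal \<in> predef" "U rdfs_Datatype \<in> predef" "U rdfs_Class \<in> predef"
  "U rdfs_subClassOf \<in> predef" "U rdfs_subPropertyOf \<in> predef" "U rdfs_member \<in> predef"
  "U rdfs_Container \<in> predef" "U rdfs_ContainerMembershipProperty \<in> predef"
  "U rdfs_comment \<in> predef" "U rdfs_seeAlso \<in> predef" "U rdfs_isDefinedBy \<in> predef"
  "U rdfs_label \<in> predef" "U erdf_TotalClass \<in> predef" "U erdf_TotalProperty \<in> predef"
  "PL c \<notin> predef" "TL l \<notin> predef"
  by (auto simp: predef_def V_RDF_def V_RDFS_def V_ERDF_def)

text \<open>Lets later proofs treat all axioms uniformly, as ground facts about names that lie in
  every vocabulary considered, without a case distinction over the list of axioms.\<close>

lemma axiomatic_triple_predef: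
  fixes t :: "('u, 'p, 's, unit) fm"
  assumes "t \<in> rdf_axioms \<union> rdfs_axioms \<union> erdf_axioms"
  shows "\<exists>p s o'. t = ax p s o' \<and> {U p, U s, U o'} \<subseteq> (predef :: ('u, 'p, 's) sym set)"
  using assms unfolding rdf_axioms_def rdfs_axioms_def erdf_axioms_def ax_def
  by (elim UnE CollectE insertE emptyE exE conjE) simp_all

lemma models_ax:
  "models V I (ax p s t) \<longleftrightarrow> U p \<in> V \<and> U s \<in> V \<and> U t \<in> V \<and> IV I p \<in> Props I \<and>
     (IV I s, IV I t) \<in> PT I (IV I p)"
  by (auto simp: models_def ax_def)

lemma erdf_interpD:
  assumes "erdf_interp X V I"
  shows "partial_interp (V \<union> predef) I" "coherent I"
   "Cls I \<subseteq> Res I" "TCls I \<subseteq> Cls I" "TProp I \<subseteq> Props I"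
   "\<forall>y\<in>Cls I. CT I y \<subseteq> Res I \<and> CF I y \<subseteq> Res I"
   "\<forall>y. y \<notin> Cls I \<longrightarrow> CT I y = {} \<and> CF I y = {}"
   "\<forall>x y. x \<in> CT I y \<longleftrightarrow> (x, y) \<in> PT I (IV I rdf_type)"
   "\<forall>x y. x \<in> CF I y \<longleftrightarrow> (x, y) \<in> PF I (IV I rdf_type)"
   "Props I = CT I (IV I rdf_Property)"
   "Cls I = CT I (IV I rdfs_Class)"
   "Res I = CT I (IV I rdfs_Resource)"
   "LV I = CT I (IV I rdfs_Literal)"
   "TCls I = CT I (IV I erdf_TotalClass)"
   "TProp I = CT I (IV I erdf_TotalProperty)"
   "\<forall>x y z w. (x, y) \<in> PT I (IV I rdfs_domain) \<and> (z, w) \<in> PT I x \<longrightarrow> z \<in> CT I y"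
   "\<forall>x y z w. (x, y) \<in> PT I (IV I rdfs_range) \<and> (z, w) \<in> PT I x \<longrightarrow> w \<in> CT I y"
   "\<forall>x\<in>Cls I. (x, IV I rdfs_Resource) \<in> PT I (IV I rdfs_subClassOf)"
   "\<forall>x y. (x, y) \<in> PT I (IV I rdfs_subClassOf) \<longrightarrow>
        x \<in> Cls I \<and> y \<in> Cls I \<and> CT I x \<subseteq> CT I y \<and> CF I y \<subseteq> CF I x"
   "refl_on (Cls I) (PT I (IV I rdfs_subClassOf))"
   "trans_on (Cls I) (PT I (IV I rdfs_subClassOf))"
   "\<forall>x y. (x, y) \<in> PT I (IV I rdfs_subPropertyOf) \<longrightarrow>
        x \<in> Props I \<and> y \<in> Props I \<and> PT I x \<subseteq> PT I y \<and> PF I y \<subseteq> PF I x"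
   "refl_on (Props I) (PT I (IV I rdfs_subPropertyOf))"
   "trans_on (Props I) (PT I (IV I rdfs_subPropertyOf))"
   "\<forall>x\<in>CT I (IV I rdfs_Datatype). (x, IV I rdfs_Literal) \<in> PT I (IV I rdfs_subClassOf)"
   "\<forall>x\<in>CT I (IV I rdfs_ContainerMembershipProperty).
        (x, IV I rdfs_member) \<in> PT I (IV I rdfs_subPropertyOf)"
   "\<forall>x\<in>TCls I. CT I x \<union> CF I x = Res I"
   "\<forall>x\<in>TProp I. PT I x \<union> PF I x = Res I \<times> Res I"
   "\<forall>s. TL (s, rdf_XMLLiteral) \<in> V \<and> s \<in> X \<longrightarrow>
        IL I (s, rdf_XMLLiteral) = XMLval s \<and>
        IL I (s, rdf_XMLLiteral) \<in> CT I (IV I rdf_XMLLiteral)"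
   "\<forall>s. TL (s, rdf_XMLLiteral) \<in> V \<and> s \<notin> X \<longrightarrow>
        IL I (s, rdf_XMLLiteral) \<in> Res I - LV I \<and>
        IL I (s, rdf_XMLLiteral) \<in> CF I (IV I rdfs_Literal)"
   "\<forall>t \<in> rdf_axioms \<union> rdfs_axioms \<union> erdf_axioms. models (V \<union> predef) I t"
  using assms unfolding erdf_interp_def by - (elim conjE, assumption)+

text \<open>The tables default to the empty set outside \<open>Props\<close>, so an entry in a table
  already shows that its index is a property.\<close>

lemma partial_interpD:
  assumes "partial_interp V I"
  shows "\<And>p x y. (x, y) \<in> PT I p \<Longrightarrow> p \<in> Props I \<and> x \<in> Res I \<and> y \<in> Res I"
    "\<And>p x y. (x, y) \<in> PF I p \<Longrightarrow> p \<in> Props I \<and> x \<in> Res I \<and> y \<in> Res I"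
    "\<And>u. U u \<in> V \<Longrightarrow> IV I u \<in> Res I \<union> Props I"
    "\<And>l. TL l \<in> V \<Longrightarrow> IL I l \<in> Res I"
    "\<And>c. PL c \<in> V \<Longrightarrow> RSym (PL c) \<in> LV I"
    "IV I \<in> extensional {u. U u \<in> V}" "IL I \<in> extensional {l. TL l \<in> V}"
  using assms unfolding partial_interp_def PiE_def by blast+

section \<open>Herbrand interpretations as pairs of tables\<close>

text \<open>
  A Herbrand interpretation is determined by the extensions \<open>T\<close>, \<open>N\<close> of \<open>PT\<close>, \<open>PF\<close>.
\<close>

locale herbrand_tables =
  fixes X :: "'s set" and V :: "('u, 'p, 's) sym set"
    and T N :: "('u, 'p, 's, 'e) res \<Rightarrow> (('u, 'p, 's, 'e) res \<times> ('u, 'p, 's, 'e) res) set"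
  assumes T_dom: "(x, y) \<in> T p \<Longrightarrow>
      x \<in> herbrand_res X V \<and> y \<in> herbrand_res X V \<and> (p, rsc rdf_Property) \<in> T (rsc rdf_type)"
    and N_dom: "(x, y) \<in> N p \<Longrightarrow>
      x \<in> herbrand_res X V \<and> y \<in> herbrand_res X V \<and> (p, rsc rdf_Property) \<in> T (rsc rdf_type)"
    and coh: "(x, y) \<in> T p \<Longrightarrow> (x, y) \<notin> N p"
    and cls: "(x, y) \<in> T (rsc rdf_type) \<Longrightarrow> (y, rsc rdfs_Class) \<in> T (rsc rdf_type)"
    and cls': "(x, y) \<in> N (rsc rdf_type) \<Longrightarrow> (y, rsc rdfs_Class) \<in> T (rsc rdf_type)"
    and tcls: "(x, rsc erdf_TotalClass) \<in> T (rsc rdf_type) \<Longrightarrow> (x, rsc rdfs_Class) \<in> T (rsc rdf_type)"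
    and tprop: "(x, rsc erdf_TotalProperty) \<in> T (rsc rdf_type) \<Longrightarrow>
      (x, rsc rdf_Property) \<in> T (rsc rdf_type)"
    and res: "x \<in> herbrand_res X V \<Longrightarrow> (x, rsc rdfs_Resource) \<in> T (rsc rdf_type)"
    and plain: "PL c \<in> V \<Longrightarrow> (RSym (PL c), rsc rdfs_Literal) \<in> T (rsc rdf_type)"
    and dom: "(x, y) \<in> T (rsc rdfs_domain) \<Longrightarrow> (z, w) \<in> T x \<Longrightarrow> (z, y) \<in> T (rsc rdf_type)"
    and ran: "(x, y) \<in> T (rsc rdfs_range) \<Longrightarrow> (z, w) \<in> T x \<Longrightarrow> (w, y) \<in> T (rsc rdf_type)"
    and sc_res: "(x, rsc rdfs_Class) \<in> T (rsc rdf_type) \<Longrightarrow>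
      (x, rsc rdfs_Resource) \<in> T (rsc rdfs_subClassOf)"
    and sc_cls: "(x, y) \<in> T (rsc rdfs_subClassOf) \<Longrightarrow>
      (x, rsc rdfs_Class) \<in> T (rsc rdf_type) \<and> (y, rsc rdfs_Class) \<in> T (rsc rdf_type)"
    and sc_T: "(x, y) \<in> T (rsc rdfs_subClassOf) \<Longrightarrow> (z, x) \<in> T (rsc rdf_type) \<Longrightarrow>
      (z, y) \<in> T (rsc rdf_type)"
    and sc_N: "(x, y) \<in> T (rsc rdfs_subClassOf) \<Longrightarrow> (z, y) \<in> N (rsc rdf_type) \<Longrightarrow>
      (z, x) \<in> N (rsc rdf_type)"
    and sc_refl: "(x, rsc rdfs_Class) \<in> T (rsc rdf_type) \<Longrightarrow> (x, x) \<in> T (rsc rdfs_subClassOf)"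
    and sc_trans: "(x, y) \<in> T (rsc rdfs_subClassOf) \<Longrightarrow> (y, z) \<in> T (rsc rdfs_subClassOf) \<Longrightarrow>
      (x, z) \<in> T (rsc rdfs_subClassOf)"
    and sp_prop: "(x, y) \<in> T (rsc rdfs_subPropertyOf) \<Longrightarrow>
      (x, rsc rdf_Property) \<in> T (rsc rdf_type) \<and> (y, rsc rdf_Property) \<in> T (rsc rdf_type)"
    and sp_T: "(x, y) \<in> T (rsc rdfs_subPropertyOf) \<Longrightarrow> (z, w) \<in> T x \<Longrightarrow> (z, w) \<in> T y"
    and sp_N: "(x, y) \<in> T (rsc rdfs_subPropertyOf) \<Longrightarrow> (z, w) \<in> N y \<Longrightarrow> (z, w) \<in> N x"
    and sp_refl: "(x, rsc rdf_Property) \<in> T (rsc rdf_type) \<Longrightarrow> (x, x) \<in> T (rsc rdfs_subPropertyOf)"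
    and sp_trans: "(x, y) \<in> T (rsc rdfs_subPropertyOf) \<Longrightarrow> (y, z) \<in> T (rsc rdfs_subPropertyOf) \<Longrightarrow>
      (x, z) \<in> T (rsc rdfs_subPropertyOf)"
    and dtype: "(x, rsc rdfs_Datatype) \<in> T (rsc rdf_type) \<Longrightarrow>
      (x, rsc rdfs_Literal) \<in> T (rsc rdfs_subClassOf)"
    and cmp: "(x, rsc rdfs_ContainerMembershipProperty) \<in> T (rsc rdf_type) \<Longrightarrow>
      (x, rsc rdfs_member) \<in> T (rsc rdfs_subPropertyOf)"
    and total_cls: "(x, rsc erdf_TotalClass) \<in> T (rsc rdf_type) \<Longrightarrow> z \<in> herbrand_res X V \<Longrightarrow>
      (z, x) \<in> T (rsc rdf_type) \<or> (z, x) \<in> N (rsc rdf_type)"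
    and total_prop: "(x, rsc erdf_TotalProperty) \<in> T (rsc rdf_type) \<Longrightarrow> z \<in> herbrand_res X V \<Longrightarrow>
      w \<in> herbrand_res X V \<Longrightarrow> (z, w) \<in> T x \<or> (z, w) \<in> N x"
    and xml: "TL (s, rdf_XMLLiteral) \<in> V \<Longrightarrow> s \<in> X \<Longrightarrow>
      (XMLval s, rsc rdf_XMLLiteral) \<in> T (rsc rdf_type)"
    and nonxml: "TL (s, rdf_XMLLiteral) \<in> V \<Longrightarrow> s \<notin> X \<Longrightarrow>
      (RSym (TL (s, rdf_XMLLiteral)), rsc rdfs_Literal) \<in> N (rsc rdf_type)"
    and axiomatic: "(ax u a b :: ('u, 'p, 's, unit) fm) \<in> rdf_axioms \<union> rdfs_axioms \<union> erdf_axioms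
      \<Longrightarrow> (rsc a, rsc b) \<in> T (rsc u)"

text \<open>The inverse image under \<open>h\<close>, cut down to \<open>R\<close>. The index
  \<open>p\<close> is restricted too, because \<open>T_dom\<close> demands that the index of a
  nonempty table be typed as a property in the pulled-back type table, which only relates elements
  of \<open>R\<close>.\<close>

definition pull :: "'a set \<Rightarrow> ('a \<Rightarrow> 'b) \<Rightarrow> ('b \<Rightarrow> ('b \<times> 'b) set) \<Rightarrow> 'a \<Rightarrow> ('a \<times> 'a) set" where
  "pull R h T p = {(x, y). p \<in> R \<and> x \<in> R \<and> y \<in> R \<and> (h x, h y) \<in> T (h p)}"

lemma mem_pull: "(x, y) \<in> pull R h T p \<longleftrightarrow> p \<in> R \<and> x \<in> R \<and> y \<in> R \<and> (h x, h y) \<in> T (h p)"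
  by (simp add: pull_def)

lemma herbrand_res_mem [simp]:
  "rsc u \<in> herbrand_res X V \<longleftrightarrow> U u \<in> V"
  "RSym (PL c) \<in> herbrand_res X V \<longleftrightarrow> PL c \<in> V"
  "RSym (TL (s, d)) \<in> herbrand_res X V \<longleftrightarrow> TL (s, d) \<in> V \<and> \<not> (d = rdf_XMLLiteral \<and> s \<in> X)"
  "XMLval s \<in> herbrand_res X V \<longleftrightarrow> TL (s, rdf_XMLLiteral) \<in> V \<and> s \<in> X"
  by (auto simp: herbrand_res_def)

text \<open>The conditions on tables are mostly implications between atoms whose only constants are
  predefined names, and \<open>h\<close> maps those names to their denotations in \<open>I\<close>;
  such implications pass to preimages. Coherence passes because both tables are pulled back along
  the same map, and totality because \<open>h\<close> maps into \<open>Res I\<close>. The last three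
  assumptions on \<open>h\<close> cover the literals.\<close>

lemma pullback_tables:
  fixes I :: "('u, 'p, 's, 'e) einterp" and V :: "('u, 'p, 's) sym set"
    and h :: "('u, 'p, 's, 'e) res \<Rightarrow> ('u, 'p, 's, 'e) res"
  assumes I: "erdf_interp X V' I" and V: "predef \<subseteq> V"
    and hR: "\<And>x. x \<in> herbrand_res X V \<Longrightarrow> h x \<in> Res I"
    and hU: "\<And>u. U u \<in> (predef :: ('u, 'p, 's) sym set) \<Longrightarrow> h (rsc u) = IV I u"
    and hPL: "\<And>c. PL c \<in> V \<Longrightarrow> h (RSym (PL c)) \<in> LV I"
    and hX: "\<And>s. TL (s, rdf_XMLLiteral) \<in> V \<Longrightarrow> s \<in> X \<Longrightarrow> h (XMLval s) \<in> CT I (IV I rdf_XMLLiteral)"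
    and hN: "\<And>s. TL (s, rdf_XMLLiteral) \<in> V \<Longrightarrow> s \<notin> X \<Longrightarrow>
      h (RSym (TL (s, rdf_XMLLiteral))) \<in> CF I (IV I rdfs_Literal)"
  shows "herbrand_tables X V (pull (herbrand_res X V) h (PT I)) (pull (herbrand_res X V) h (PF I))"
proof -
  note D = erdf_interpD[OF I]
  note P = partial_interpD[OF D(1)]
  \<comment> \<open>From here on the conditions on \<open>I\<close> are restated in terms of
    \<open>PT\<close> and \<open>PF\<close> alone, in the shape of the locale assumptions.\<close>
  have CT: "CT I y = {x. (x, y) \<in> PT I (IV I rdf_type)}"
    and CF: "CF I y = {x. (x, y) \<in> PF I (IV I rdf_type)}" for y using D(8,9) by auto
  let ?t = "PT I (IV I rdf_type)" and ?n = "PF I (IV I rdf_type)"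
    and ?sc = "PT I (IV I rdfs_subClassOf)" and ?sp = "PT I (IV I rdfs_subPropertyOf)"
  have reg: "Props I = {x. (x, IV I rdf_Property) \<in> ?t}" "Cls I = {x. (x, IV I rdfs_Class) \<in> ?t}"
    "LV I = {x. (x, IV I rdfs_Literal) \<in> ?t}" "TCls I = {x. (x, IV I erdf_TotalClass) \<in> ?t}"
    "TProp I = {x. (x, IV I erdf_TotalProperty) \<in> ?t}"
    using D(10,11,13,14,15) CT by auto
  have pre: "U u \<in> V" if "U u \<in> (predef :: ('u, 'p, 's) sym set)" for u using V that by blast
  have dom: "(x, y) \<in> PT I p \<Longrightarrow> (p, IV I rdf_Property) \<in> ?t"
    "(x, y) \<in> PF I p \<Longrightarrow> (p, IV I rdf_Property) \<in> ?t" for x y p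
    using P(1,2) reg(1) by blast+
  have coh: "(x, y) \<in> PT I p \<Longrightarrow> (x, y) \<notin> PF I p" for x y p
    using P(1) D(2) unfolding coherent_def by blast
  have cls: "(x, y) \<in> ?t \<or> (x, y) \<in> ?n \<Longrightarrow> (y, IV I rdfs_Class) \<in> ?t" for x y
    using D(7) CT CF reg(2) by blast
  have tot: "(x, IV I erdf_TotalClass) \<in> ?t \<Longrightarrow> (x, IV I rdfs_Class) \<in> ?t"
    "(x, IV I erdf_TotalProperty) \<in> ?t \<Longrightarrow> (x, IV I rdf_Property) \<in> ?t"
    "x \<in> Res I \<Longrightarrow> (x, IV I rdfs_Resource) \<in> ?t" for x
    using D(4,5,12) reg CT by blast+
  have dr: "(x, y) \<in> PT I (IV I rdfs_domain) \<Longrightarrow> (z, w) \<in> PT I x \<Longrightarrow> (z, y) \<in> ?t"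
    "(x, y) \<in> PT I (IV I rdfs_range) \<Longrightarrow> (z, w) \<in> PT I x \<Longrightarrow> (w, y) \<in> ?t" for x y z w
    using D(16,17) CT by blast+
  have sc: "(x, IV I rdfs_Class) \<in> ?t \<Longrightarrow> (x, IV I rdfs_Resource) \<in> ?sc"
    "(x, y) \<in> ?sc \<Longrightarrow> (x, IV I rdfs_Class) \<in> ?t \<and> (y, IV I rdfs_Class) \<in> ?t"
    "(x, y) \<in> ?sc \<Longrightarrow> (z, x) \<in> ?t \<Longrightarrow> (z, y) \<in> ?t"
    "(x, y) \<in> ?sc \<Longrightarrow> (z, y) \<in> ?n \<Longrightarrow> (z, x) \<in> ?n"
    "(x, IV I rdfs_Class) \<in> ?t \<Longrightarrow> (x, x) \<in> ?sc" for x y z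
    using D(18,19,20) CT CF reg(2) unfolding refl_on_def by blast+
  have sct: "(x, y) \<in> ?sc \<Longrightarrow> (y, z) \<in> ?sc \<Longrightarrow> (x, z) \<in> ?sc" for x y z
    using D(19,21) unfolding trans_on_def by blast
  have sp: "(x, y) \<in> ?sp \<Longrightarrow> (x, IV I rdf_Property) \<in> ?t \<and> (y, IV I rdf_Property) \<in> ?t"
    "(x, y) \<in> ?sp \<Longrightarrow> (z, w) \<in> PT I x \<Longrightarrow> (z, w) \<in> PT I y"
    "(x, y) \<in> ?sp \<Longrightarrow> (z, w) \<in> PF I y \<Longrightarrow> (z, w) \<in> PF I x"
    "(x, IV I rdf_Property) \<in> ?t \<Longrightarrow> (x, x) \<in> ?sp" for x y z w
    using D(22,23) reg(1) unfolding refl_on_def by blast+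
  have spt: "(x, y) \<in> ?sp \<Longrightarrow> (y, z) \<in> ?sp \<Longrightarrow> (x, z) \<in> ?sp" for x y z
    using D(22,24) unfolding trans_on_def by blast
  have dc: "(x, IV I rdfs_Datatype) \<in> ?t \<Longrightarrow> (x, IV I rdfs_Literal) \<in> ?sc"
    "(x, IV I rdfs_ContainerMembershipProperty) \<in> ?t \<Longrightarrow> (x, IV I rdfs_member) \<in> ?sp" for x
    using D(25,26) CT by blast+
  have total: "(x, IV I erdf_TotalClass) \<in> ?t \<Longrightarrow> z \<in> Res I \<Longrightarrow> (z, x) \<in> ?t \<or> (z, x) \<in> ?n"
    "(x, IV I erdf_TotalProperty) \<in> ?t \<Longrightarrow> z \<in> Res I \<Longrightarrow> w \<in> Res I \<Longrightarrow>
      (z, w) \<in> PT I x \<or> (z, w) \<in> PF I x" for x z w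
    using D(27,28) reg(4,5) CT CF by blast+
  show ?thesis
  \<comment> \<open>The case numbers follow the order of the locale assumptions. In each case
    \<open>pre\<close> and \<open>hU\<close> replace predefined names by their denotations in
    \<open>I\<close>, and the matching fact about \<open>I\<close> applies.\<close>
  proof (unfold_locales, unfold mem_pull, goal_cases)
    case 1 then show ?case using dom(1) by (simp add: pre hU; blast)
  next
    case 2 then show ?case using dom(2) by (simp add: pre hU; blast)
  next
    case 3 then show ?case using coh by (simp add: pre hU; blast)
  next
    case 4 then show ?case using cls by (simp add: pre hU; blast)
  next
    case 5 then show ?case using cls by (simp add: pre hU; blast)
  next
    case 6 then show ?case using tot(1) by (simp add: pre hU; blast)
  next
    case 7 then show ?case using tot(2) by (simp add: pre hU; blast)
  next
    case 8 then show ?case using tot(3) by (simp add: pre hU hR; blast)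
  next
    case 9 then show ?case using hPL by (simp add: pre hU reg(3); blast)
  next
    case 10 then show ?case using dr(1) by (simp add: pre hU; blast)
  next
    case 11 then show ?case using dr(2) by (simp add: pre hU; blast)
  next
    case 12 then show ?case using sc(1) by (simp add: pre hU; blast)
  next
    case 13 then show ?case using sc(2) by (simp add: pre hU; blast)
  next
    case 14 then show ?case using sc(3) by (simp add: pre hU; blast)
  next
    case 15 then show ?case using sc(4) by (simp add: pre hU; blast)
  next
    case 16 then show ?case using sc(5) by (simp add: pre hU; blast)
  next
    case 17 then show ?case using sct by (simp add: pre hU; blast)
  next
    case 18 then show ?case using sp(1) by (simp add: pre hU; blast)
  next
    case 19 then show ?case using sp(2) by (simp add: pre hU; blast)
  next
    case 20 then show ?case using sp(3) by (simp add: pre hU; blast)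
  next
    case 21 then show ?case using sp(4) by (simp add: pre hU; blast)
  next
    case 22 then show ?case using spt by (simp add: pre hU; blast)
  next
    case 23 then show ?case using dc(1) by (simp add: pre hU; blast)
  next
    case 24 then show ?case using dc(2) by (simp add: pre hU; blast)
  next
    case 25 then show ?case using total(1) by (simp add: pre hU hR; blast)
  next
    case 26 then show ?case using total(2) by (simp add: pre hU hR; blast)
  next
    case 27 then show ?case using hX by (simp add: pre hU CT; blast)
  next
    case 28 then show ?case using hN by (simp add: pre hU CF; blast)
  next
    case (29 p a b)
    have "{U p, U a, U b} \<subseteq> (predef :: ('u, 'p, 's) sym set)"
      using axiomatic_triple_predef[OF 29] by (auto simp: ax_def)
    moreover have "(IV I a, IV I b) \<in> PT I (IV I p)"
      using bspec[OF D(31) 29] unfolding models_ax by blast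
    ultimately show ?case by (simp add: pre hU)
  qed
qed

text \<open>The fields not fixed by the Herbrand condition are read off the tables. The value
  \<open>undefined\<close> outside \<open>V\<close> agrees with the extensionality required of
  \<open>IV\<close> and \<open>IL\<close>, so that a given Herbrand interpretation can be equal to
  such a record.\<close>

definition herb :: "'s set \<Rightarrow> ('u, 'p, 's) sym set
    \<Rightarrow> (('u, 'p, 's, 'e) res \<Rightarrow> (('u, 'p, 's, 'e) res \<times> ('u, 'p, 's, 'e) res) set)
    \<Rightarrow> (('u, 'p, 's, 'e) res \<Rightarrow> (('u, 'p, 's, 'e) res \<times> ('u, 'p, 's, 'e) res) set)
    \<Rightarrow> ('u, 'p, 's, 'e) einterp" where
  "herb X V T N =
    \<lparr>Res = herbrand_res X V, Props = {x. (x, rsc rdf_Property) \<in> T (rsc rdf_type)},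
     IV = (\<lambda>u. if U u \<in> V then rsc u else undefined), PT = T, PF = N,
     IL = (\<lambda>(s, d). if TL (s, d) \<in> V
        then if d = rdf_XMLLiteral \<and> s \<in> X then XMLval s else RSym (TL (s, d)) else undefined),
     LV = {x. (x, rsc rdfs_Literal) \<in> T (rsc rdf_type)},
     Cls = {x. (x, rsc rdfs_Class) \<in> T (rsc rdf_type)},
     TCls = {x. (x, rsc erdf_TotalClass) \<in> T (rsc rdf_type)},
     TProp = {x. (x, rsc erdf_TotalProperty) \<in> T (rsc rdf_type)},
     CT = (\<lambda>y. {x. (x, y) \<in> T (rsc rdf_type)}), CF = (\<lambda>y. {x. (x, y) \<in> N (rsc rdf_type)})\<rparr>"

lemma herb_sel [simp]:
  "Res (herb X V T N) = herbrand_res X V"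
  "Props (herb X V T N) = {x. (x, rsc rdf_Property) \<in> T (rsc rdf_type)}"
  "IV (herb X V T N) = (\<lambda>u. if U u \<in> V then rsc u else undefined)"
  "PT (herb X V T N) = T" "PF (herb X V T N) = N"
  "IL (herb X V T N) = (\<lambda>(s, d). if TL (s, d) \<in> V
        then if d = rdf_XMLLiteral \<and> s \<in> X then XMLval s else RSym (TL (s, d)) else undefined)"
  "LV (herb X V T N) = {x. (x, rsc rdfs_Literal) \<in> T (rsc rdf_type)}"
  "Cls (herb X V T N) = {x. (x, rsc rdfs_Class) \<in> T (rsc rdf_type)}"
  "TCls (herb X V T N) = {x. (x, rsc erdf_TotalClass) \<in> T (rsc rdf_type)}"
  "TProp (herb X V T N) = {x. (x, rsc erdf_TotalProperty) \<in> T (rsc rdf_type)}"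
  "CT (herb X V T N) = (\<lambda>y. {x. (x, y) \<in> T (rsc rdf_type)})"
  "CF (herb X V T N) = (\<lambda>y. {x. (x, y) \<in> N (rsc rdf_type)})"
  by (simp_all add: herb_def)

text \<open>Once every URI of \<open>V\<close> denotes itself, the clauses of
  \<open>erdf_interp\<close> turn into the locale assumptions; \<open>predef \<subseteq> V\<close>
  makes \<open>V\<close> and \<open>V \<union> predef\<close> the same vocabulary.\<close>

lemma (in herbrand_tables) herb_herbrand:
  assumes V: "predef \<subseteq> V"
  shows "herb X V T N \<in> herbrand X V"
proof -
  have un: "V \<union> predef = V" using V by blast
  have pre [simp]: "U u \<in> V" if "U u \<in> (predef :: ('u, 'p, 's) sym set)" for u using V that by blast
  have Res: "herbrand_res X V = {x. (x, rsc rdfs_Resource) \<in> T (rsc rdf_type)}"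
    using res T_dom by blast
  have "rsc rdf_type \<in> herbrand_res X V" by simp
  then have ne: "herbrand_res X V \<noteq> {}" by blast
  have ax: "\<forall>t \<in> rdf_axioms \<union> rdfs_axioms \<union> erdf_axioms. models V (herb X V T N) t"
  proof
    fix t :: "('u, 'p, 's, unit) fm" assume t: "t \<in> rdf_axioms \<union> rdfs_axioms \<union> erdf_axioms"
    obtain p a b where eq: "t = ax p a b" and m: "{U p, U a, U b} \<subseteq> (predef :: ('u, 'p, 's) sym set)"
      using axiomatic_triple_predef[OF t] by blast
    have "(rsc a, rsc b) \<in> T (rsc p)" using axiomatic t eq by blast
    \<comment> \<open>Satisfaction also asks that the predicate denote a property;
      \<open>T_dom\<close> derives this from the table entry itself.\<close>
    then show "models V (herb X V T N) t" using m T_dom unfolding eq models_ax by auto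
  qed
  have part: "partial_interp V (herb X V T N)"
    unfolding partial_interp_def using ne T_dom N_dom plain
    by (auto simp: PiE_def extensional_def split: prod.splits)
  have "erdf_interp X V (herb X V T N)"
    unfolding erdf_interp_def un
    apply (intro conjI ax part)
    subgoal using coh by (auto simp: coherent_def)
    subgoal using T_dom by auto
    subgoal using tcls by auto
    subgoal using tprop by auto
    subgoal using T_dom N_dom by auto
    subgoal using cls cls' by auto
    subgoal by simp
    subgoal by simp
    subgoal by simp
    subgoal by simp
    subgoal by (simp add: Res)
    subgoal by simp
    subgoal by simp
    subgoal by simp
    subgoal using dom by auto
    subgoal using ran by auto
    subgoal using sc_res by auto
    subgoal using sc_cls sc_T sc_N by auto
    subgoal using sc_refl by (auto simp: refl_on_def)
    subgoal using sc_trans by (auto simp: trans_on_def)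
    subgoal using sp_prop sp_T sp_N by auto
    subgoal using sp_refl by (auto simp: refl_on_def)
    subgoal using sp_trans by (auto simp: trans_on_def)
    subgoal using dtype by auto
    subgoal using cmp by auto
    subgoal using total_cls T_dom N_dom by auto
    subgoal using total_prop T_dom N_dom by fastforce
    subgoal using xml by auto
    \<comment> \<open>An ill-typed XML literal is a negative instance of
      \<open>rdfs_Literal\<close>; coherence therefore keeps it out of \<open>LV\<close>.\<close>
    subgoal using nonxml coh by auto
    done
  then show ?thesis by (auto simp: herbrand_def)
qed

lemma herbrandD:
  assumes "I \<in> herbrand X V"
  shows "erdf_interp X V I" "Res I = herbrand_res X V" "\<And>u. U u \<in> V \<Longrightarrow> IV I u = rsc u"
   "\<And>s d. TL (s, d) \<in> V \<Longrightarrow>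
      IL I (s, d) = (if d = rdf_XMLLiteral \<and> s \<in> X then XMLval s else RSym (TL (s, d)))"
  using assms unfolding herbrand_def by auto

text \<open>\<open>Res\<close>, \<open>IV\<close> and \<open>IL\<close> are prescribed, and every
  other field is a class extension of a predefined name, hence a section of the table of
  \<open>rdf_type\<close>. Equality and order of Herbrand interpretations thus reduce to their
  tables.\<close>

lemma herbrand_eq_herb:
  assumes I: "I \<in> herbrand X V" and V: "predef \<subseteq> V"
  shows "I = herb X V (PT I) (PF I)"
proof -
  note H = herbrandD[OF I]
  note D = erdf_interpD[OF H(1)]
  have un: "V \<union> predef = V" using V by blast
  note P = partial_interpD[OF D(1)[unfolded un]]
  have pre: "U u \<in> V" if "U u \<in> (predef :: ('a, 'b, 'c) sym set)" for u using V that by blast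
  have iv: "IV I = (\<lambda>u. if U u \<in> V then rsc u else undefined)"
    using P(6) H(3) by (auto simp: extensional_def)
  have il: "IL I = (\<lambda>(s, d). if TL (s, d) \<in> V
        then if d = rdf_XMLLiteral \<and> s \<in> X then XMLval s else RSym (TL (s, d)) else undefined)"
    using P(7) H(4) by (auto simp: extensional_def)
  have CT: "CT I = (\<lambda>y. {x. (x, y) \<in> PT I (rsc rdf_type)})"
    and CF: "CF I = (\<lambda>y. {x. (x, y) \<in> PF I (rsc rdf_type)})"
    using D(8,9) by (auto simp: iv pre)
  show ?thesis
    using H(2) D(10,11,13,14,15) CT CF
    by (intro einterp.equality pinterp.equality) (simp_all add: iv il pre)
qed

text \<open>Obtained as the pullback along the identity, which saves a second check of all closure
  conditions.\<close>

lemma herbrand_tables_of_herbrand: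
  assumes I: "I \<in> herbrand X V" and V: "predef \<subseteq> V"
  shows "herbrand_tables X V (PT I) (PF I)"
proof -
  note H = herbrandD[OF I]
  note D = erdf_interpD[OF H(1)]
  have un: "V \<union> predef = V" using V by blast
  note P = partial_interpD[OF D(1)[unfolded un]]
  \<comment> \<open>A class extension is empty or consists of resources, so properties are resources
    and cutting the tables down to \<open>herbrand_res X V\<close> removes nothing.\<close>
  have "Props I \<subseteq> Res I" using D(7,10,12) D(6) by blast
  then have "pull (herbrand_res X V) id (PT I) = PT I" "pull (herbrand_res X V) id (PF I) = PF I"
    using P(1,2) H(2) by (fastforce simp: pull_def)+
  moreover have "herbrand_tables X V (pull (herbrand_res X V) id (PT I)) (pull (herbrand_res X V) id (PF I))"
  proof (rule pullback_tables[OF H(1) V])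
    show "id (rsc u) = IV I u" if "U u \<in> (predef :: ('a, 'b, 'c) sym set)" for u
      using that H(3) V by auto
    show "id (RSym (PL c)) \<in> LV I" if "PL c \<in> V" for c using P(5) that by simp
    show "id (XMLval s) \<in> CT I (IV I rdf_XMLLiteral)" if "TL (s, rdf_XMLLiteral) \<in> V" "s \<in> X" for s
      using D(29) that by auto
    show "id (RSym (TL (s, rdf_XMLLiteral))) \<in> CF I (IV I rdfs_Literal)"
      if "TL (s, rdf_XMLLiteral) \<in> V" "s \<notin> X" for s
      using D(30) that H(4)[OF that(1)] by auto
  qed (use H(2) in auto)
  ultimately show ?thesis by simp
qed

section \<open>The order on Herbrand interpretations and intersections of chains\<close>

text \<open>The bound on \<open>p\<close> in the order is harmless because tables are empty outside
  \<open>Props\<close>. Conversely \<open>Props\<close> is read off the table of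
  \<open>rdf_type\<close>, so its inclusion follows from that of the tables.\<close>

lemma herbrand_le_iff:
  assumes "I \<in> herbrand X V" "J \<in> herbrand X V" "predef \<subseteq> V"
  shows "I \<preceq> J \<longleftrightarrow> (\<forall>p. PT I p \<subseteq> PT J p \<and> PF I p \<subseteq> PF J p)"
proof
  assume "I \<preceq> J"
  then show "\<forall>p. PT I p \<subseteq> PT J p \<and> PF I p \<subseteq> PF J p"
    using partial_interpD(1,2)[OF erdf_interpD(1)[OF herbrandD(1)[OF assms(1)]]]
    unfolding interp_le_def by fast
next
  assume le: "\<forall>p. PT I p \<subseteq> PT J p \<and> PF I p \<subseteq> PF J p"
  have "Props I \<subseteq> Props J"
    unfolding arg_cong[OF herbrand_eq_herb[OF assms(1,3)], of Props]
      arg_cong[OF herbrand_eq_herb[OF assms(2,3)], of Props] using le by auto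
  then show "I \<preceq> J" using le by (simp add: interp_le_def)
qed

lemma herbrand_le_antisym:
  assumes "I \<in> herbrand X V" "J \<in> herbrand X V" "predef \<subseteq> V" "I \<preceq> J" "J \<preceq> I"
  shows "I = J"
proof -
  have "PT I = PT J" "PF I = PF J"
    using assms(4,5) unfolding herbrand_le_iff[OF assms(1,2,3)] herbrand_le_iff[OF assms(2,1,3)]
    by (auto intro!: ext)
  then show ?thesis using herbrand_eq_herb[OF assms(1,3)] herbrand_eq_herb[OF assms(2,3)] by simp
qed

text \<open>Conditions of Horn form hold in an intersection because they hold in every member.
  Coherence and membership in \<open>herbrand_res X V\<close> are inherited from any single member,
  which is where \<open>S\<close> must be nonempty.\<close>

lemma chain_Inter_tables:
  assumes ne: "S \<noteq> {}"
    and tab: "\<And>I. I \<in> S \<Longrightarrow> herbrand_tables X V (PT I) (PF I)"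
    and chain: "\<And>I J. I \<in> S \<Longrightarrow> J \<in> S \<Longrightarrow>
      (\<forall>p. PT I p \<subseteq> PT J p \<and> PF I p \<subseteq> PF J p) \<or> (\<forall>p. PT J p \<subseteq> PT I p \<and> PF J p \<subseteq> PF I p)"
  shows "herbrand_tables X V (\<lambda>p. \<Inter>I\<in>S. PT I p) (\<lambda>p. \<Inter>I\<in>S. PF I p)"
proof -
  obtain I0 where I0: "I0 \<in> S" using ne by blast
  \<comment> \<open>the totality conditions are disjunctive; they survive the intersection because \<open>S\<close> is a chain\<close>
  have total: "q \<in> (\<Inter>I\<in>S. PT I x) \<or> q \<in> (\<Inter>I\<in>S. PF I x)"
    if "\<And>I. I \<in> S \<Longrightarrow> q \<in> PT I x \<or> q \<in> PF I x" for q x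
  proof (rule ccontr)
    assume "\<not> ?thesis"
    then obtain I J where "I \<in> S" "J \<in> S" "q \<notin> PT I x" "q \<notin> PF J x" by blast
    then show False using that chain[of I J] by blast
  qed
  show ?thesis
  proof (unfold_locales, goal_cases)
    case 1 then show ?case using I0 by (auto dest: herbrand_tables.T_dom[OF tab])
  next
    case 2 then show ?case using I0 by (auto dest: herbrand_tables.N_dom[OF tab])
  next
    case 3 then show ?case using I0 by (auto dest: herbrand_tables.coh[OF tab])
  next
    case 25 then show ?case using herbrand_tables.total_cls[OF tab] by (intro total) auto
  next
    case 26 then show ?case using herbrand_tables.total_prop[OF tab] by (intro total) auto
  next
    case 4 then show ?case using herbrand_tables.cls[OF tab] by (simp; blast)
  next
    case 5 then show ?case using herbrand_tables.cls'[OF tab] by (simp; blast)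
  next
    case 6 then show ?case using herbrand_tables.tcls[OF tab] by (simp; blast)
  next
    case 7 then show ?case using herbrand_tables.tprop[OF tab] by (simp; blast)
  next
    case 8 then show ?case using herbrand_tables.res[OF tab] by (simp; blast)
  next
    case 9 then show ?case using herbrand_tables.plain[OF tab] by (simp; blast)
  next
    case 10 then show ?case using herbrand_tables.dom[OF tab] by (simp; blast)
  next
    case 11 then show ?case using herbrand_tables.ran[OF tab] by (simp; blast)
  next
    case 12 then show ?case using herbrand_tables.sc_res[OF tab] by (simp; blast)
  next
    case 13 then show ?case using herbrand_tables.sc_cls[OF tab] by (simp; blast)
  next
    case 14 then show ?case using herbrand_tables.sc_T[OF tab] by (simp; blast)
  next
    case 15 then show ?case using herbrand_tables.sc_N[OF tab] by (simp; blast)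
  next
    case 16 then show ?case using herbrand_tables.sc_refl[OF tab] by (simp; blast)
  next
    case 17 then show ?case using herbrand_tables.sc_trans[OF tab] by (simp; blast)
  next
    case 18 then show ?case using herbrand_tables.sp_prop[OF tab] by (simp; blast)
  next
    case 19 then show ?case using herbrand_tables.sp_T[OF tab] by (simp; blast)
  next
    case 20 then show ?case using herbrand_tables.sp_N[OF tab] by (simp; blast)
  next
    case 21 then show ?case using herbrand_tables.sp_refl[OF tab] by (simp; blast)
  next
    case 22 then show ?case using herbrand_tables.sp_trans[OF tab] by (simp; blast)
  next
    case 23 then show ?case using herbrand_tables.dtype[OF tab] by (simp; blast)
  next
    case 24 then show ?case using herbrand_tables.cmp[OF tab] by (simp; blast)
  next
    case 27 then show ?case using herbrand_tables.xml[OF tab] by (simp; blast)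
  next
    case 28 then show ?case using herbrand_tables.nonxml[OF tab] by (simp; blast)
  next
    case 29 then show ?case using herbrand_tables.axiomatic[OF tab] by (simp; blast)
  qed
qed

section \<open>Satisfaction of triples and of the skolemized graph\<close>

lemma erdf_triple_cases:
  assumes "erdf_triple t"
  obtains p a b where "t = Tr p a b" | p a b where "t = Neg (Tr p a b)"
  using assms by (cases t rule: erdf_triple.cases) auto

lemma tden_tinst: "tden I w (tinst (\<lambda>x. Sym (\<sigma> x)) a) = tden I (\<lambda>x. den I (\<sigma> x)) a"
  by (cases a) auto

lemma tsyms_tinst: "tsyms (tinst (\<lambda>x. Sym (\<sigma> x)) a) = tsyms a \<union> \<sigma> ` tvars a"
  by (cases a) auto

text \<open>Triples bind no variables, so substituting symbols amounts to evaluating at their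
  denotations. The condition on \<open>\<sigma>\<close> is there because satisfaction also requires
  the inserted symbols to belong to \<open>V\<close>.\<close>

lemma sat_inst_triple:
  assumes "erdf_triple t" "\<sigma> ` vars t \<subseteq> V"
  shows "sat V I w (inst (\<lambda>x. Sym (\<sigma> x)) t) \<longleftrightarrow> sat V I (\<lambda>x. den I (\<sigma> x)) t"
  using assms(1) by (rule erdf_triple_cases) (use assms(2) in \<open>auto simp: tden_tinst tsyms_tinst\<close>)

lemma gsyms_skolemize:
  assumes "erdf_graph G"
  shows "gsyms (skolemize sk G) = gsyms G \<union> U ` sk ` gvars G"
proof -
  have "syms (inst (\<lambda>x. Sym (U (sk x))) t) = syms t \<union> U ` sk ` vars t" if "t \<in> G" for t
  proof -
    have "erdf_triple t" using that assms by (simp add: erdf_graph_def)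
    then show ?thesis
      by (rule erdf_triple_cases) (auto simp: tsyms_tinst[where \<sigma> = "\<lambda>x. U (sk x)"])
  qed
  then have "gsyms (skolemize sk G) = (\<Union>t\<in>G. syms t \<union> U ` sk ` vars t)"
    by (simp add: gsyms_def skolemize_def)
  then show ?thesis by (simp only: UN_Un_distrib image_UN gsyms_def[of G] gvars_def)
qed

lemma onto_voc_no_rules:
  assumes "erdf_graph G"
  shows "onto_voc sk G {} = gsyms G \<union> U ` sk ` gvars G \<union> predef"
  using gsyms_skolemize[OF assms] by (simp add: onto_voc_def)

text \<open>The skolemized graph is ground, so the valuation in \<open>models_graph\<close> is
  irrelevant, and the denotations of the skolem URIs act as a valuation for
  \<open>G\<close>.\<close>

lemma models_skolemize:
  fixes I :: "('u, 'p, 's, 'e, 'm) pinterp_scheme" and G :: "('u, 'p, 's, 'v) fm set"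
  assumes "erdf_graph G" "U ` sk ` gvars G \<subseteq> V"
  shows "models_graph V I (skolemize sk G) \<longleftrightarrow> (\<forall>t\<in>G. sat V I (\<lambda>x. IV I (sk x)) t)"
proof -
  have s: "sat V I w (inst (\<lambda>x. Sym (U (sk x))) t) \<longleftrightarrow> sat V I (\<lambda>x. IV I (sk x)) t" if "t \<in> G" for w t
  proof -
    have "erdf_triple t" "U ` sk ` vars t \<subseteq> V"
      using that assms unfolding erdf_graph_def gvars_def by blast+
    then show ?thesis using sat_inst_triple[of t "\<lambda>x. U (sk x)" V I w] by (simp add: image_image)
  qed
  have "gvars (skolemize sk G) = {}"
  proof -
    have "vars (inst (\<lambda>x. Sym (U (sk x))) t) = {}" if "t \<in> G" for t
    proof -
      have tv: "tvars (tinst (\<lambda>x. Sym (U (sk x))) a) = {}" for a :: "('u, 'p, 's, 'v) trm"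
        by (cases a) auto
      have "erdf_triple t" using that assms(1) by (simp add: erdf_graph_def)
      then show ?thesis by (rule erdf_triple_cases) (simp_all add: tv)
    qed
    then show ?thesis by (auto simp: gvars_def skolemize_def)
  qed
  then show ?thesis using s by (auto simp: models_graph_def skolemize_def)
qed

lemma sat_triple_syms: "erdf_triple t \<Longrightarrow> sat V I v t \<Longrightarrow> syms t \<subseteq> V"
  by (erule erdf_triple_cases) auto

section \<open>Preservation of positive existential formulas under homomorphisms\<close>

text \<open>Strong negation occurs in \<open>F\<close> only on triples, and weak negation,
  implication and universal quantifiers do not occur, so a map preserving both tables preserves
  truth. The symbol condition can be limited to \<open>V\<close> because a triple true in
  \<open>M\<close> uses only symbols of \<open>V\<close>. The valuations are linked only at free
  variables, since the quantifiers overwrite the others.\<close>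

lemma ex_triple_disj_hom:
  fixes F :: "('u, 'p, 's, 'v) fm"
  assumes hR: "\<And>x. x \<in> Res M \<Longrightarrow> h x \<in> Res I"
    and hc: "\<And>c. c \<in> syms F \<Longrightarrow> c \<in> V \<Longrightarrow> c \<in> V' \<and> h (den M c) = den I c"
    and hP: "\<And>p. p \<in> Props M \<Longrightarrow> h p \<in> Props I"
    and hT: "\<And>p x y. p \<in> Props M \<Longrightarrow> (x, y) \<in> PT M p \<Longrightarrow> (h x, h y) \<in> PT I (h p)"
    and hF: "\<And>p x y. p \<in> Props M \<Longrightarrow> (x, y) \<in> PF M p \<Longrightarrow> (h x, h y) \<in> PF I (h p)"
    and F: "ex_triple_disj F" and "sat V M v F"
    and "w \<in> vars F \<rightarrow> Res I" and "\<And>y. y \<in> fvars F \<Longrightarrow> w y = h (v y)"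
  shows "sat V' I w F"
proof -
  have trip: "sat V' I w t" if t: "erdf_triple t" and hc: "\<And>c. c \<in> syms t \<Longrightarrow> c \<in> V \<Longrightarrow> c \<in> V' \<and> h (den M c) = den I c"
    and s: "sat V M v t" and wv: "\<And>y. y \<in> fvars t \<Longrightarrow> w y = h (v y)"
    for t :: "('u, 'p, 's, 'v) fm" and v w
  proof -
    have td: "tden I w a = h (tden M v a)" if "tvars a \<subseteq> fvars t" "tsyms a \<subseteq> syms t" "tsyms a \<subseteq> V" for a
      using that wv hc by (cases a) auto
    show ?thesis using t
    proof (rule erdf_triple_cases)
      fix p a b assume eq: "t = Tr p a b"
      have m: "tden I w a = h (tden M v a)" "tden I w b = h (tden M v b)"
        using s by (auto simp: eq intro!: td)
      have "IV I p = h (IV M p)" using hc[of "U p"] s by (simp add: eq)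
      moreover have "\<forall>c\<in>insert (U p) (tsyms a \<union> tsyms b). c \<in> V'"
        using hc s by (auto simp: eq)
      ultimately show ?thesis using s hP hT by (auto simp: eq m)
    next
      fix p a b assume eq: "t = Neg (Tr p a b)"
      have m: "tden I w a = h (tden M v a)" "tden I w b = h (tden M v b)"
        using s by (auto simp: eq intro!: td)
      have "IV I p = h (IV M p)" using hc[of "U p"] s by (simp add: eq)
      moreover have "\<forall>c\<in>insert (U p) (tsyms a \<union> tsyms b). c \<in> V'"
        using hc s by (auto simp: eq)
      ultimately show ?thesis using s hP hF by (auto simp: eq m)
    qed
  qed
  have conj: "sat V' I w F" if "triple_conj F" "\<And>c. c \<in> syms F \<Longrightarrow> c \<in> V \<Longrightarrow> c \<in> V' \<and> h (den M c) = den I c"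
    "sat V M v F" "\<And>y. y \<in> fvars F \<Longrightarrow> w y = h (v y)"
    for F :: "('u, 'p, 's, 'v) fm" and v w
    using that by (induction F rule: triple_conj.induct) (auto intro: trip)
  have ex: "sat V' I w F" if "ex_triple_conj F" "\<And>c. c \<in> syms F \<Longrightarrow> c \<in> V \<Longrightarrow> c \<in> V' \<and> h (den M c) = den I c"
    "sat V M v F" "w \<in> vars F \<rightarrow> Res I" "\<And>y. y \<in> fvars F \<Longrightarrow> w y = h (v y)"
    for F :: "('u, 'p, 's, 'v) fm" and v w
    using that
  proof (induction F arbitrary: v w rule: ex_triple_conj.induct)
    case (2 F x)
    obtain u where u: "u \<in> vars F \<rightarrow> Res M" "\<forall>y\<in>vars F - {x}. u y = v y" "sat V M u F"
      using 2(4) by auto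
    have fv: "fvars F \<subseteq> vars F" by (induction F) auto
    \<comment> \<open>The image of the witness found in \<open>M\<close> serves as witness in
      \<open>I\<close>. Elsewhere \<open>w\<close> is kept rather than replaced by
      \<open>h \<circ> u\<close>, because the new valuation has to agree with \<open>w\<close> on
      all other variables, free or not.\<close>
    let ?w = "w(x := h (u x))"
    have "?w \<in> vars F \<rightarrow> Res I" using 2(5) u(1) hR by (auto simp: Pi_iff)
    moreover have "?w y = h (u y)" if "y \<in> fvars F" for y
      using 2(6)[of y] that u(2) fv by auto
    ultimately have "sat V' I ?w F" using 2 u(3) by auto
    moreover have "\<forall>y\<in>vars F - {x}. ?w y = w y" by simp
    ultimately show ?case using \<open>?w \<in> vars F \<rightarrow> Res I\<close> unfolding sat.simps by blast
  qed (use conj in blast)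
  show ?thesis using F assms(2,7-)
  proof (induction F rule: ex_triple_disj.induct)
    case (1 F) then show ?case using ex by blast
  next
    case (2 F F') then show ?case by (auto simp: Pi_iff)
  qed
qed

section \<open>Stable models in the absence of rules\<close>

text \<open>Without rules, each link of the chain must be minimal among all Herbrand interpretations
  above its predecessor, hence equal to it. The chain is constant and only the condition on
  \<open>C 0\<close> remains.\<close>

lemma stable_model_no_rules:
  fixes G :: "('u, 'p, 's, 'v) fm set" and sk :: "'v \<Rightarrow> 'u uri" and M :: "('u, 'p, 's, 'e) einterp"
  assumes G: "erdf_graph G"
  defines "V \<equiv> onto_voc sk G {}"
  shows "stable_model X sk G {} M \<longleftrightarrow> M \<in> minimal {I \<in> herbrand X V. models_graph V I (skolemize sk G)}"
    (is "_ \<longleftrightarrow> M \<in> minimal ?A")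
proof
  have V: "predef \<subseteq> V" unfolding V_def onto_voc_def by blast
  have refl: "I \<preceq> I" for I :: "('u, 'p, 's, 'e) einterp" by (simp add: interp_le_def)
  have min: "minimal {I \<in> herbrand X V. C \<preceq> I} = {C}" if C: "C \<in> herbrand X V" for C :: "('u, 'p, 's, 'e) einterp"
  proof
    show "{C} \<subseteq> minimal {I \<in> herbrand X V. C \<preceq> I}"
      using C refl herbrand_le_antisym[OF _ C V] by (auto simp: minimal_def)
    show "minimal {I \<in> herbrand X V. C \<preceq> I} \<subseteq> {C}"
      using C refl[of C] by (auto simp: minimal_def)
  qed
  have gr: "ground_rules V {} = {}" by (simp add: ground_rules_def)
  define st where "st k C \<longleftrightarrow> (\<forall>\<alpha>\<le>k + 1. C \<alpha> \<in> herbrand X V) \<and> (\<forall>\<alpha>\<le>k. C \<alpha> \<preceq> C (\<alpha> + 1)) \<and>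
    C k = M \<and> C (k + 1) = M \<and> C 0 \<in> minimal ?A \<and>
    (\<forall>\<alpha>. 0 < \<alpha> \<and> \<alpha> \<le> k + 1 \<longrightarrow> C \<alpha> \<in> minimal {I\<in>herbrand X V. C (\<alpha> - 1) \<preceq> I})"
    for k :: nat and C :: "nat \<Rightarrow> ('u, 'p, 's, 'e) einterp"
  have stable: "stable_model X sk G {} M \<longleftrightarrow> M \<in> herbrand X V \<and> (\<exists>k C. st k C)"
    unfolding stable_model_def V_def[symmetric] Let_def gr ball_empty simp_thms st_def ..
  show "M \<in> minimal ?A" if sm: "stable_model X sk G {} M"
  proof -
    obtain k C where C: "st k C" using sm stable by blast
    have "C n = C 0" if "n \<le> k" for n using that
    proof (induction n)
      case (Suc n)
      then have "0 < Suc n \<and> Suc n \<le> k + 1" by simp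
      then have "C (Suc n) \<in> minimal {I\<in>herbrand X V. C (Suc n - 1) \<preceq> I}"
        using C unfolding st_def by blast
      moreover have "C n \<in> herbrand X V" using C Suc unfolding st_def by simp
      ultimately show ?case using min[of "C n"] Suc by simp
    qed simp
    from this[of k] have "C k = C 0" by simp
    moreover have "C k = M" "C 0 \<in> minimal ?A" using C unfolding st_def by blast+
    ultimately show ?thesis by simp
  qed
  show "stable_model X sk G {} M" if m: "M \<in> minimal ?A"
  proof -
    have H: "M \<in> herbrand X V" using m by (simp add: minimal_def)
    then have "M \<in> minimal {I \<in> herbrand X V. M \<preceq> I}" by (simp add: min)
    \<comment> \<open>With \<open>k = 0\<close> the chain still has the two links \<open>C 0\<close>
      and \<open>C 1\<close>; the clause for \<open>\<alpha> = 1\<close> asks that \<open>M\<close>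
      be minimal above itself.\<close>
    then have "st 0 (\<lambda>_. M)" unfolding st_def using H m refl[of M] by (intro conjI) simp_all
    then show ?thesis using H unfolding stable by blast
  qed
qed

section \<open>Existence of minimal Herbrand models\<close>

lemma minimal_model_below:
  fixes J :: "('u, 'p, 's, 'e) einterp"
  assumes G: "erdf_graph G" and V: "predef \<subseteq> V" "U ` sk ` gvars G \<subseteq> V"
    and J: "J \<in> herbrand X V" "models_graph V J (skolemize sk G)"
  shows "\<exists>M. M \<in> minimal {I \<in> herbrand X V. models_graph V I (skolemize sk G)} \<and> M \<preceq> J"
proof -
  let ?H = "herbrand X V :: ('u, 'p, 's, 'e) einterp set"
  let ?M = "{I \<in> ?H. models_graph V I (skolemize sk G)}"
  let ?A = "{I \<in> ?M. I \<preceq> J}"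
  \<comment> \<open>The order is reversed because Zorn's lemma yields maximal elements. Restricting
    to models below \<open>J\<close> puts the resulting element below \<open>J\<close> as
    well.\<close>
  let ?r = "relation_of (\<lambda>I I'. I' \<preceq> I) ?A"
  have refl: "I \<preceq> I" for I :: "('u, 'p, 's, 'e) einterp" by (simp add: interp_le_def)
  have trans: "I \<preceq> K" if "I \<preceq> I'" "I' \<preceq> K" for I I' K :: "('u, 'p, 's, 'e) einterp"
    using that unfolding interp_le_def by blast
  have po: "partial_order_on ?A ?r"
  proof (rule partial_order_on_relation_ofI)
    show "I' = K" if "I' \<in> ?A" "K \<in> ?A" "K \<preceq> I'" "I' \<preceq> K" for I' K
      using herbrand_le_antisym[OF _ _ V(1), of I' X K] that by blast
  qed (rule refl, rule trans)
  have "\<exists>m\<in>?A. \<forall>I\<in>?A. I \<preceq> m \<longrightarrow> I = m"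
  proof (rule predicate_Zorn[OF po])
    fix S assume "S \<in> Chains ?r"
    then have SA: "S \<subseteq> ?A" and ch: "\<And>I I'. I \<in> S \<Longrightarrow> I' \<in> S \<Longrightarrow> I \<preceq> I' \<or> I' \<preceq> I"
      unfolding Chains_def relation_of_def by blast+
    show "\<exists>u\<in>?A. \<forall>I\<in>S. u \<preceq> I"
    proof (cases "S = {}")
      case True then show ?thesis using J refl by auto
    next
      case ne: False
      have SH: "I \<in> ?H" if "I \<in> S" for I using that SA by blast
      let ?T = "\<lambda>p. \<Inter>I\<in>S. PT I p" and ?N = "\<lambda>p. \<Inter>I\<in>S. PF I p"
      let ?I = "herb X V ?T ?N"
      have tab: "herbrand_tables X V ?T ?N"
      proof (rule chain_Inter_tables[OF ne])
        show "herbrand_tables X V (PT I) (PF I)" if "I \<in> S" for I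
          using herbrand_tables_of_herbrand[OF SH[OF that] V(1)] .
        show "(\<forall>p. PT I p \<subseteq> PT I' p \<and> PF I p \<subseteq> PF I' p) \<or> (\<forall>p. PT I' p \<subseteq> PT I p \<and> PF I' p \<subseteq> PF I p)"
          if "I \<in> S" "I' \<in> S" for I I'
          using ch[OF that] herbrand_le_iff[OF SH SH V(1)] that by blast
      qed
      have I: "?I \<in> ?H" by (rule herbrand_tables.herb_herbrand[OF tab V(1)])
      have le: "?I \<preceq> I" if "I \<in> S" for I
        unfolding herbrand_le_iff[OF I SH[OF that] V(1)] using that by auto
      have "sat V ?I (\<lambda>x. IV ?I (sk x)) t" if t: "t \<in> G" for t
      proof -
        have et: "erdf_triple t" using G t by (simp add: erdf_graph_def)
        have s: "sat V I (\<lambda>x. IV I (sk x)) t" if "I \<in> S" for I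
          using that SA t models_skolemize[OF G V(2), of I] by blast
        obtain I0 where I0: "I0 \<in> S" using ne by blast
        have skV: "U (sk x) \<in> V" if "x \<in> vars t" for x using that t V(2) by (auto simp: gvars_def)
        \<comment> \<open>All Herbrand interpretations over \<open>V\<close> share their
          denotations, so a triple of \<open>sk(G)\<close> refers to the same table entry in every
          member of the chain and in the intersection.\<close>
        have den: "den I c = den ?I c" if "c \<in> V" "I \<in> S" for c I
          using herbrandD(3,4)[OF SH[OF that(2)]] that(1) by (cases c) auto
        have tden: "tden I (\<lambda>x. IV I (sk x)) a = tden ?I (\<lambda>x. IV ?I (sk x)) a"
          if "tsyms a \<subseteq> V" "tvars a \<subseteq> vars t" "I \<in> S" for a I
        proof (cases a)
          case (Var x)
          then have "U (sk x) \<in> V" using that(2) skV by auto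
          then show ?thesis using Var den[of "U (sk x)" I] that(3) by simp
        next
          case (Sym c) then show ?thesis using that den by simp
        qed
        \<comment> \<open>Being a property is an entry in the table of \<open>rdf_type\<close>, so
          it is intersected along with the tables.\<close>
        have P: "p \<in> Props ?I" if "\<And>I. I \<in> S \<Longrightarrow> p \<in> Props I" for p
        proof -
          have "p \<in> Props I \<Longrightarrow> I \<in> S \<Longrightarrow> (p, rsc rdf_Property) \<in> PT I (rsc rdf_type)" for I
            using arg_cong[OF herbrand_eq_herb[OF SH V(1)], of I Props] by auto
          then show ?thesis using that by auto
        qed
        show ?thesis using et
        proof (rule erdf_triple_cases)
          fix p a b assume eq: "t = Tr p a b"
          have syms: "U p \<in> V" "tsyms a \<subseteq> V" "tsyms b \<subseteq> V" using s[OF I0] by (auto simp: eq)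
          have "den ?I (U p) \<in> Props ?I"
            using s den[OF syms(1)] by (intro P) (auto simp: eq simp del: herb_sel)
          moreover have "(tden ?I (\<lambda>x. IV ?I (sk x)) a, tden ?I (\<lambda>x. IV ?I (sk x)) b) \<in> PT I (den ?I (U p))"
            if "I \<in> S" for I
            using s[OF that] tden[OF syms(2) _ that] tden[OF syms(3) _ that] den[OF syms(1) that]
            by (simp add: eq del: herb_sel)
          ultimately show ?thesis using syms by (auto simp: eq simp del: den.simps)
        next
          fix p a b assume eq: "t = Neg (Tr p a b)"
          have syms: "U p \<in> V" "tsyms a \<subseteq> V" "tsyms b \<subseteq> V" using s[OF I0] by (auto simp: eq)
          have "den ?I (U p) \<in> Props ?I"
            using s den[OF syms(1)] by (intro P) (auto simp: eq simp del: herb_sel)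
          moreover have "(tden ?I (\<lambda>x. IV ?I (sk x)) a, tden ?I (\<lambda>x. IV ?I (sk x)) b) \<in> PF I (den ?I (U p))"
            if "I \<in> S" for I
            using s[OF that] tden[OF syms(2) _ that] tden[OF syms(3) _ that] den[OF syms(1) that]
            by (simp add: eq del: herb_sel)
          ultimately show ?thesis using syms by (auto simp: eq simp del: den.simps)
        qed
      qed
      then have "models_graph V ?I (skolemize sk G)" using models_skolemize[OF G V(2), of ?I] by blast
      moreover have "?I \<preceq> J"
      proof -
        obtain I0 where "I0 \<in> S" using ne by blast
        then show ?thesis using trans[OF le] SA by blast
      qed
      ultimately show ?thesis using I le by blast
    qed
  qed
  then obtain m where m: "m \<in> ?A" and min: "\<forall>I\<in>?A. I \<preceq> m \<longrightarrow> I = m"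
    by (elim bexE) (rule that)
  \<comment> \<open>Whatever lies below \<open>m\<close> lies below \<open>J\<close>, so minimality
    within \<open>?A\<close> is minimality among all Herbrand models of
    \<open>sk(G)\<close>.\<close>
  have "I = m" if "I \<in> ?M" "I \<preceq> m" for I
  proof -
    have "I \<preceq> J" by (rule trans[OF that(2)]) (use m in simp)
    then show ?thesis using min that by simp
  qed
  then have "m \<in> minimal ?M" using m by (auto simp: minimal_def)
  then show ?thesis using m by blast
qed

section \<open>Pulling an ERDF model of the graph back to a Herbrand model\<close>

text \<open>The tables of \<open>J\<close> are full preimages on \<open>R\<close>, so truth in
  \<open>I\<close> can be read back along \<open>h\<close> as soon as the valuation \<open>u\<close>
  lifts to some \<open>w\<close> with values in \<open>R\<close>.\<close>

lemma sat_triple_pull: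
  assumes "erdf_triple t" "syms t \<subseteq> V'"
    and "sat V I u t"
    and "\<And>c. c \<in> syms t \<Longrightarrow> h (den J c) = den I c" "\<And>c. c \<in> syms t \<Longrightarrow> den J c \<in> R"
    and "\<And>x. x \<in> vars t \<Longrightarrow> h (w x) = u x" "\<And>x. x \<in> vars t \<Longrightarrow> w x \<in> R"
    and "PT J = pull R h (PT I)" "PF J = pull R h (PF I)"
    and "\<And>p. p \<in> R \<Longrightarrow> h p \<in> Props I \<Longrightarrow> p \<in> Props J"
  shows "sat V' J w t"
proof -
  have td: "h (tden J w a) = tden I u a \<and> tden J w a \<in> R" if "tvars a \<subseteq> vars t" "tsyms a \<subseteq> syms t" for a
    using assms that by (cases a) auto
  show ?thesis using assms(1)
  proof (rule erdf_triple_cases)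
    fix p a b assume eq: "t = Tr p a b"
    have "h (tden J w a) = tden I u a \<and> tden J w a \<in> R" "h (tden J w b) = tden I u b \<and> tden J w b \<in> R"
      "h (IV J p) = IV I p \<and> IV J p \<in> R"
      using td[of a] td[of b] assms(4,5)[of "U p"] by (auto simp: eq)
    then show ?thesis using assms(2,3,8,9) assms(10)[of "IV J p"] by (simp add: eq mem_pull)
  next
    fix p a b assume eq: "t = Neg (Tr p a b)"
    have "h (tden J w a) = tden I u a \<and> tden J w a \<in> R" "h (tden J w b) = tden I u b \<and> tden J w b \<in> R"
      "h (IV J p) = IV I p \<and> IV J p \<in> R"
      using td[of a] td[of b] assms(4,5)[of "U p"] by (auto simp: eq)
    then show ?thesis using assms(2,3,8,9) assms(10)[of "IV J p"] by (simp add: eq mem_pull)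
  qed
qed

text \<open>The map \<open>h\<close> is handed out together with \<open>J\<close>, because it later
  transports \<open>F\<close> to \<open>I\<close>. Agreement with the denotations of
  \<open>I\<close> is claimed only off the skolem URIs: these may happen to belong to
  \<open>V'\<close> and denote something other than the chosen witnesses.\<close>

lemma herbrand_preimage:
  fixes I :: "('u, 'p, 's, 'e) einterp" and G :: "('u, 'p, 's, 'v) fm set" and sk :: "'v \<Rightarrow> 'u uri"
  assumes G: "erdf_graph G" and sk: "skolemization sk G"
    and I: "erdf_interp X V' I" and mod: "models_graph (V' \<union> predef) I G"
  defines "V \<equiv> onto_voc sk G {}"
  obtains J :: "('u, 'p, 's, 'e) einterp" and h where
    "J \<in> herbrand X V" "models_graph V J (skolemize sk G)"
    "\<And>x. x \<in> herbrand_res X V \<Longrightarrow> h x \<in> Res I"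
    "\<And>c. c \<in> V - U ` sk ` gvars G \<Longrightarrow> c \<in> V' \<union> predef \<and> h (den J c) = den I c"
    "PT J = pull (herbrand_res X V) h (PT I)" "PF J = pull (herbrand_res X V) h (PF I)"
proof -
  note D = erdf_interpD[OF I]
  note P = partial_interpD[OF D(1)]
  have Veq: "V = gsyms G \<union> U ` sk ` gvars G \<union> predef"
    unfolding V_def by (rule onto_voc_no_rules[OF G])
  have V: "predef \<subseteq> V" "U ` sk ` gvars G \<subseteq> V" unfolding Veq by auto
  obtain u where u: "u \<in> gvars G \<rightarrow> Res I" "\<And>t. t \<in> G \<Longrightarrow> sat (V' \<union> predef) I u t"
    using mod unfolding models_graph_def by blast
  \<comment> \<open>A satisfied triple has all its symbols in the vocabulary; only the skolem URIs
    may be unknown to \<open>I\<close>.\<close>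
  have gV: "gsyms G \<subseteq> V' \<union> predef"
    using sat_triple_syms u(2) G unfolding gsyms_def erdf_graph_def by blast
  have inj: "inj_on sk (gvars G)" and fresh: "U ` sk ` gvars G \<inter> (gsyms G \<union> predef) = {}"
    using sk unfolding skolemization_def by auto
  have PR: "Props I \<subseteq> Res I" using D(6,7,10,12) by blast
  have LVR: "LV I \<subseteq> Res I" using D(1) by (simp add: partial_interp_def)
  \<comment> \<open>XML values stay in place since \<open>I\<close> also interprets the well-typed
    XML literals of its vocabulary by \<open>XMLval s\<close>. Values \<open>Obj\<close> do not
    occur among Herbrand resources. Injectivity of \<open>sk\<close> recovers the variable behind a
    skolem URI.\<close>
  define h :: "('u, 'p, 's, 'e) res \<Rightarrow> ('u, 'p, 's, 'e) res" where
    "h z = (case z of RSym c \<Rightarrow> if c \<in> U ` sk ` gvars G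
         then u (the_inv_into (gvars G) (\<lambda>x. U (sk x) :: ('u, 'p, 's) sym) c) else den I c
       | _ \<Rightarrow> z)" for z
  have inj': "inj_on (\<lambda>x. U (sk x) :: ('u, 'p, 's) sym) (gvars G)"
    using inj by (simp add: inj_on_def)
  have hsk: "h (rsc (sk x)) = u x" if "x \<in> gvars G" for x
    using the_inv_into_f_f[OF inj' that] that by (auto simp: h_def)
  have hden: "h (RSym c) = den I c" if "c \<in> gsyms G \<union> predef" for c
    using that fresh by (auto simp: h_def)
  have hxml [simp]: "h (XMLval s) = XMLval s" for s by (simp add: h_def)
  have TLV: "TL l \<in> V \<longleftrightarrow> TL l \<in> gsyms G" for l unfolding Veq by auto
  have PLV: "PL c \<in> V \<longleftrightarrow> PL c \<in> gsyms G" for c unfolding Veq by auto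
  \<comment> \<open>The XML clauses of \<open>erdf_interp\<close> speak about \<open>V'\<close> and
    not \<open>V' \<union> predef\<close>; the predefined vocabulary contains no typed literals, so
    membership in \<open>V'\<close> follows.\<close>
  have TLV': "TL l \<in> V'" if "TL l \<in> V" for l using that gV TLV by auto
  have denR: "den I c \<in> Res I" if "c \<in> V' \<union> predef" for c
    using P(3,4,5) that PR LVR by (cases c) (auto; blast)+
  have hR: "h x \<in> Res I" if "x \<in> herbrand_res X V" for x
    using that
  proof (cases x)
    case (RSym c)
    then have "c \<in> V" using that by (auto simp: herbrand_res_def)
    then show ?thesis using u(1) hsk hden denR gV unfolding Veq RSym by fastforce
  next
    case (XMLval s)
    then have "TL (s, rdf_XMLLiteral) \<in> V" "s \<in> X" using that by auto
    then show ?thesis using D(29) P(4) TLV' XMLval by (metis UnI1 hxml)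
  qed (auto simp: herbrand_res_def)
  let ?R = "herbrand_res X V"
  let ?J = "herb X V (pull ?R h (PT I)) (pull ?R h (PF I))"
  have tab: "herbrand_tables X V (pull ?R h (PT I)) (pull ?R h (PF I))"
  proof (rule pullback_tables[OF I V(1) hR])
    show "h (rsc c) = IV I c" if "U c \<in> (predef :: ('u, 'p, 's) sym set)" for c
      using hden[of "U c"] that by simp
    show "h (RSym (PL c)) \<in> LV I" if "PL c \<in> V" for c
      using hden[of "PL c"] that P(5) gV PLV by auto
    show "h (XMLval s) \<in> CT I (IV I rdf_XMLLiteral)" if "TL (s, rdf_XMLLiteral) \<in> V" "s \<in> X" for s
      using D(29) that TLV' by (metis hxml)
    show "h (RSym (TL (s, rdf_XMLLiteral))) \<in> CF I (IV I rdfs_Literal)"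
      if "TL (s, rdf_XMLLiteral) \<in> V" "s \<notin> X" for s
      using D(30) that TLV' TLV hden[of "TL (s, rdf_XMLLiteral)"] by auto
  qed
  have J: "?J \<in> herbrand X V" by (rule herbrand_tables.herb_herbrand[OF tab V(1)])
  have dJ: "h (den ?J c) = den I c \<and> den ?J c \<in> ?R" if "c \<in> gsyms G \<union> predef" for c
  proof (cases c)
    \<comment> \<open>A well-typed XML literal denotes the same XML value in both interpretations,
      and \<open>h\<close> fixes it; any other typed literal denotes itself in
      \<open>?J\<close>.\<close>
    case (TL l)
    obtain s d where l: "l = (s, d)" by force
    have "TL (s, d) \<in> V" using that unfolding Veq TL l by auto
    then show ?thesis using hden[OF that] D(29) TLV'[of l] unfolding TL l by auto
  qed (use hden[OF that] that in \<open>auto simp: Veq\<close>)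
  have Pr: "p \<in> Props ?J" if "p \<in> ?R" "h p \<in> Props I" for p
    using that D(8,10) hden[of "U rdf_Property"] hden[of "U rdf_type"] by (simp add: mem_pull Veq)
  have "sat V ?J (\<lambda>x. IV ?J (sk x)) t" if t: "t \<in> G" for t
  proof (rule sat_triple_pull[where I = I and h = h and R = ?R])
    show "erdf_triple t" using t G by (simp add: erdf_graph_def)
    show "sat (V' \<union> predef) I u t" using u t by blast
    show "syms t \<subseteq> V" using t by (auto simp: Veq gsyms_def)
    show "h (den ?J c) = den I c" "den ?J c \<in> ?R" if "c \<in> syms t" for c
      using dJ[of c] that t unfolding gsyms_def by blast+
    show "h (IV ?J (sk x)) = u x" "IV ?J (sk x) \<in> ?R" if "x \<in> vars t" for x
      using that t hsk[of x] by (auto simp: gvars_def Veq)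
  qed (use Pr in auto)
  then have "models_graph V ?J (skolemize sk G)" using models_skolemize[OF G V(2), of ?J] by blast
  then show thesis
  proof (rule that[OF J _ hR])
    show "c \<in> V' \<union> predef \<and> h (den ?J c) = den I c" if "c \<in> V - U ` sk ` gvars G" for c
      using that gV dJ[of c] unfolding Veq by blast
  qed auto
qed

section \<open>The two directions between stable and ERDF entailment\<close>

text \<open>The tables of \<open>M\<close> lie inside those of \<open>J\<close>, so \<open>h\<close>
  is still a homomorphism on \<open>M\<close>. Disjointness from the skolem URIs enters at the
  symbols of \<open>F\<close>, which \<open>h\<close> must send to their denotations in
  \<open>I\<close>.\<close>

lemma stable_entails_imp_erdf_entails:
  fixes G :: "('u, 'p, 's, 'v) fm set"
  assumes G: "erdf_graph G" and sk: "skolemization sk G" and F: "d_formula F"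
    and dis: "syms F \<inter> U ` sk ` gvars G = {}" and st: "stable_entails TYPE('e) X sk G {} F"
  shows "erdf_entails TYPE('e) X G F"
  unfolding erdf_entails_def
proof (intro allI impI)
  fix V' and I :: "('u, 'p, 's, 'e) einterp"
  assume I: "erdf_interp X V' I" and mod: "models_graph (V' \<union> predef) I G"
  define V where "V = onto_voc sk G {}"
  have Veq: "V = gsyms G \<union> U ` sk ` gvars G \<union> predef"
    unfolding V_def by (rule onto_voc_no_rules[OF G])
  have V: "predef \<subseteq> V" "U ` sk ` gvars G \<subseteq> V" unfolding Veq by auto
  obtain J :: "('u, 'p, 's, 'e) einterp" and h where J: "J \<in> herbrand X V" "models_graph V J (skolemize sk G)"
    and hR: "\<And>x. x \<in> herbrand_res X V \<Longrightarrow> h x \<in> Res I"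
    and hc: "\<And>c. c \<in> V - U ` sk ` gvars G \<Longrightarrow> c \<in> V' \<union> predef \<and> h (den J c) = den I c"
    and pull: "PT J = pull (herbrand_res X V) h (PT I)" "PF J = pull (herbrand_res X V) h (PF I)"
    using herbrand_preimage[OF G sk I mod] unfolding V_def by blast
  obtain M where M: "M \<in> minimal {I \<in> herbrand X V. models_graph V I (skolemize sk G)}" "M \<preceq> J"
    using minimal_model_below[OF G V J] by blast
  then have MH: "M \<in> herbrand X V" by (simp add: minimal_def)
  have MF: "models V M F"
    using st M(1) stable_model_no_rules[OF G] unfolding stable_entails_def V_def by blast
  note le = M(2)[unfolded herbrand_le_iff[OF MH J(1) V(1)]]
  note ID = erdf_interpD[OF I]
  have dM: "den M c = den J c" if "c \<in> V" for c
    using that herbrandD(3,4)[OF MH] herbrandD(3,4)[OF J(1)] by (cases c) auto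
  have hT: "(h x, h y) \<in> PT I (h p)" if "(x, y) \<in> PT M p" for x y p
  proof -
    have "(x, y) \<in> PT J p" using that le by blast
    then show ?thesis by (simp add: pull mem_pull)
  qed
  have hF: "(h x, h y) \<in> PF I (h p)" if "(x, y) \<in> PF M p" for x y p
  proof -
    have "(x, y) \<in> PF J p" using that le by blast
    then show ?thesis by (simp add: pull mem_pull)
  qed
  have hpre: "h (rsc c) = IV I c" if "U c \<in> (predef :: ('u, 'p, 's) sym set)" for c
  proof -
    have "U c \<in> V - U ` sk ` gvars G" using that V(1) sk by (auto simp: skolemization_def)
    then have "h (den J (U c)) = IV I c" using hc by fastforce
    then show ?thesis using herbrandD(3)[OF J(1), of c] that V(1) by auto
  qed
  \<comment> \<open>Being a property is a type fact, so it is transported like any other table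
    entry.\<close>
  have hP: "h p \<in> Props I" if "p \<in> Props M" for p
  proof -
    have "(p, rsc rdf_Property) \<in> PT M (rsc rdf_type)"
      using that arg_cong[OF herbrand_eq_herb[OF MH V(1)], of Props] by auto
    from hT[OF this] show ?thesis using ID(8,10) hpre by simp
  qed
  \<comment> \<open>As \<open>F\<close> is closed, any one valuation into \<open>Res M\<close>
    suffices to start the transfer; a constant one is chosen.\<close>
  have "Res M \<noteq> {}" using erdf_interpD(1)[OF herbrandD(1)[OF MH]] by (simp add: partial_interp_def)
  then obtain r where r: "r \<in> Res M" by blast
  then have Mr: "sat V M (\<lambda>_. r) F" using MF by (simp add: models_def)
  show "models (V' \<union> predef) I F"
    unfolding models_def
  proof
    fix w assume w: "w \<in> vars F \<rightarrow> Res I"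
    show "sat (V' \<union> predef) I w F"
    proof (rule ex_triple_disj_hom[OF _ _ hP hT hF _ Mr w])
      show "h x \<in> Res I" if "x \<in> Res M" for x using that hR herbrandD(2)[OF MH] by blast
      show "c \<in> V' \<union> predef \<and> h (den M c) = den I c" if "c \<in> syms F" "c \<in> V" for c
        using hc[of c] dM[OF that(2)] that dis by auto
    qed (use F in \<open>auto simp: d_formula_def\<close>)
  qed
qed

text \<open>A stable model is itself one of the ERDF interpretations that the entailment ranges
  over, and its skolem URIs provide the valuation satisfying \<open>G\<close>.\<close>

lemma erdf_entails_imp_stable_entails:
  fixes G :: "('u, 'p, 's, 'v) fm set"
  assumes G: "erdf_graph G" and ent: "erdf_entails TYPE('e) X G F"
  shows "stable_entails TYPE('e) X sk G {} F"
  unfolding stable_entails_def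
proof (intro allI impI)
  fix M :: "('u, 'p, 's, 'e) einterp"
  assume st: "stable_model X sk G {} M"
  define V where "V = onto_voc sk G {}"
  have Veq: "V = gsyms G \<union> U ` sk ` gvars G \<union> predef"
    unfolding V_def by (rule onto_voc_no_rules[OF G])
  have V: "V \<union> predef = V" "U ` sk ` gvars G \<subseteq> V" unfolding Veq by auto
  have M: "M \<in> herbrand X V" "models_graph V M (skolemize sk G)"
    using st stable_model_no_rules[OF G] unfolding V_def minimal_def by blast+
  have "models_graph V M G"
    unfolding models_graph_def
  proof (intro bexI[of _ "\<lambda>x. IV M (sk x)"])
    show "\<forall>t\<in>G. sat V M (\<lambda>x. IV M (sk x)) t" using M(2) models_skolemize[OF G V(2)] by blast
    show "(\<lambda>x. IV M (sk x)) \<in> gvars G \<rightarrow> Res M"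
    proof
      fix x assume "x \<in> gvars G"
      then have "U (sk x) \<in> V" using V(2) by blast
      then show "IV M (sk x) \<in> Res M" using herbrandD(2,3)[OF M(1)] by simp
    qed
  qed
  then have "models V M F" using ent herbrandD(1)[OF M(1)] V(1) unfolding erdf_entails_def by metis
  then show "models (onto_voc sk G {}) M F" by (simp add: V_def)
qed

theorem proposition6p2:
  fixes X :: "'s set"
    and G :: "('u, 'p, 's, 'v) fm set"
    and F :: "('u, 'p, 's, 'v) fm"
    and sk :: "'v \<Rightarrow> 'u uri"
  assumes "erdf_graph G"
    and "erdf_formula F"
    and "skolemization sk G"
    and "syms F \<inter> U ` sk ` gvars G = {}"
  shows "(d_formula F \<longrightarrow> stable_entails TYPE('e) X sk G {} F \<longrightarrow> erdf_entails TYPE('e) X G F) \<and>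
         (erdf_entails TYPE('e) X G F \<longrightarrow> stable_entails TYPE('e) X sk G {} F)"
  using stable_entails_imp_erdf_entails[OF assms(1,3) _ assms(4)]
    erdf_entails_imp_stable_entails[OF assms(1)] by (intro conjI impI)

end
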